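(* Let $d=1$ and $J_n=|n|^{-(1+\alpha)}$ for $n\in\mathbb{Z}\setminus\{0\}$, $J_0=0$. For every $\alpha\in(0,\infty)$ there exists $C=C(\alpha)>0$ such that for all $t\in\mathbb{R}$ and all $\phi\in l^1(\mathbb{Z})$, $$\|U(t)\phi\|_{l^\infty}\le C\langle t\rangle^{-\rho}\|\phi\|_{l^1},$$ where $\rho=\frac13$ if $\alpha\in(1,\infty)$ and $\rho=\frac12$ if $\alpha\in(0,1]$.
   Context: $\langle t\rangle=(1+t^2)^{1/2}$. $(Lu)_n=\sum_{m\ne n}J_{n-m}(u_n-u_m)$ on $l^2(\mathbb{Z})$, and $U(t)=e^{-itL}$ is the linear flow of $i\dot u=Lu$. Explicitly $U(t)\phi=K_t*\phi$ with $(K_t)_n=\frac1{2\pi}\int_{-\pi}^{\pi}e^{i(n\xi-\sigma(\xi)t)}\,d\xi$, where, up to a positive constant factor that can be removed by rescaling time, $\sigma(\xi)=\sum_{k=1}^\infty\frac{\sin^2(k\xi/2)}{k^{1+\alpha}}$. *)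

theory Defs
  imports "HOL-Analysis.Analysis"
begin

definition l1 :: "(int \<Rightarrow> complex) set" where
  "l1 = {u. (\<lambda>n. norm (u n)) summable_on UNIV}"

definition l1_norm :: "(int \<Rightarrow> complex) \<Rightarrow> real" where
  "l1_norm u = (\<Sum>\<^sub>\<infinity>n. norm (u n))"

definition l2 :: "(int \<Rightarrow> complex) set" where
  "l2 = {u. (\<lambda>n. (norm (u n))\<^sup>2) summable_on UNIV}"

definition l2_norm :: "(int \<Rightarrow> complex) \<Rightarrow> real" where
  "l2_norm u = sqrt (\<Sum>\<^sub>\<infinity>n. (norm (u n))\<^sup>2)"

definition linf :: "(int \<Rightarrow> complex) set" where
  "linf = {u. bounded (range u)}"

definition linf_norm :: "(int \<Rightarrow> complex) \<Rightarrow> real" where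
  "linf_norm u = (SUP n. norm (u n))"

definition japanese_bracket :: "real \<Rightarrow> real" where
  "japanese_bracket t = (1 + t\<^sup>2) powr (1/2)"

definition power_law_coupling :: "real \<Rightarrow> int \<Rightarrow> real" where
  "power_law_coupling \<alpha> n = (if n = 0 then 0 else \<bar>real_of_int n\<bar> powr - (1 + \<alpha>))"

definition lattice_op :: "(int \<Rightarrow> real) \<Rightarrow> (int \<Rightarrow> complex) \<Rightarrow> int \<Rightarrow> complex" where
  "lattice_op J u n = (\<Sum>\<^sub>\<infinity>m\<in>UNIV - {n}. of_real (J (n - m)) * (u n - u m))"

definition flow_partial_sum ::
  "(int \<Rightarrow> real) \<Rightarrow> real \<Rightarrow> nat \<Rightarrow> (int \<Rightarrow> complex) \<Rightarrow> int \<Rightarrow> complex" where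
  "flow_partial_sum J t N \<phi> n =
     (\<Sum>k<N. (- (\<i> * of_real t)) ^ k / fact k * (lattice_op J ^^ k) \<phi> n)"

text \<open>
  For summable couplings \<open>J\<close> the operator \<open>L = lattice_op J\<close> is bounded on \<open>l2\<close>, and
  \<open>U(t) = exp (- i t L)\<close> is given by its exponential series. For \<open>\<phi>\<close> in \<open>l2\<close>, the vector
  \<open>U(t) \<phi>\<close> is the unique limit in \<open>l2\<close> norm of the partial sums, which all lie in \<open>l2\<close>.
\<close>
definition linear_flow ::
  "(int \<Rightarrow> real) \<Rightarrow> real \<Rightarrow> (int \<Rightarrow> complex) \<Rightarrow> int \<Rightarrow> complex" where
  "linear_flow J t \<phi> = (THE u. u \<in> l2 \<and>
     (\<lambda>N. l2_norm (\<lambda>n. flow_partial_sum J t N \<phi> n - u n)) \<longlonglongrightarrow> 0)"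

end

theory Submission
  imports Defs
begin

text \<open>
  The flow is convolution with the Fourier coefficients \<open>K\<^sub>t\<close> of \<open>exp (- i t \<sigma>)\<close>, where
  \<open>\<sigma> x = 2 (\<Sum>k\<ge>1. k powr - (1 + \<alpha>) * (1 - cos (k x)))\<close>, so only the supremum norm of \<open>K\<^sub>t\<close> has to
  be estimated. This is done by van der Corput's method for smooth approximations of \<open>\<sigma>\<close>,
  uniformly in the approximation.

  For \<open>\<alpha> \<le> 1\<close> the sequence \<open>a k = k powr (1 - \<alpha>)\<close> is concave, and a double summation by parts turns
  \<open>(2 - 2 cos x) \<sigma>''(x)\<close> into \<open>- 2 (\<Sum>k\<ge>1. d k * (1 - cos (k x)))\<close> with
  \<open>d k = 2 a k - a (k - 1) - a (k + 1) \<ge> 0\<close>. Hence \<open>\<sigma>'' \<le> - d 1 < 0\<close>, which gives the decay rate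
  \<open>1/2\<close>. Fejer weights make the sums finite.

  For \<open>\<alpha> > 1\<close> one writes \<open>k powr (1 - \<alpha>)\<close> as a mixture of the exponentials \<open>exp (- k s)\<close> and uses
  \<open>(\<Sum>k\<ge>1. k * r ^ k * sin (k x)) = r (1 - r\<^sup>2) sin x / (1 - 2 r cos x + r\<^sup>2)\<^sup>2\<close> to see that the
  derivative of \<open>\<sigma>''\<close> is at most \<open>- \<gamma> sin x\<close> on \<open>[0, \<pi>]\<close>. Since \<open>\<sigma>'\<close> vanishes at \<open>0\<close> and \<open>\<pi>\<close>,
  \<open>\<sigma>''\<close> has a zero \<open>z\<close> away from the end points and \<open>\<bar>\<sigma>''(x)\<bar> \<ge> c \<bar>x - z\<bar>\<close>, which gives the decay
  rate \<open>1/3\<close>. Abel weights \<open>\<rho> ^ k\<close> provide the smoothness.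
\<close>

section \<open>Van der Corput estimates\<close>

text \<open>By the second mean value theorem the integral equals
  \<open>g a * (F c - F a) + g b * (F b - F c)\<close> for some \<open>c\<close>. Each increment of
  \<open>F\<close> is at most 2 in size, which gives the constant 4. The decreasing case follows by
  passing to \<open>- g\<close>.\<close>

lemma integral_monotone_mult_derivative_bound:
  fixes F f g :: "real \<Rightarrow> real"
  assumes ab: "a \<le> b"
    and F: "\<And>x. x \<in> {a..b} \<Longrightarrow> (F has_real_derivative f x) (at x within {a..b})"
    and bd: "\<And>x. x \<in> {a..b} \<Longrightarrow> \<bar>F x\<bar> \<le> 1"
    and g: "(\<forall>x y. a \<le> x \<and> x \<le> y \<and> y \<le> b \<longrightarrow> g x \<le> g y) \<or>
            (\<forall>x y. a \<le> x \<and> x \<le> y \<and> y \<le> b \<longrightarrow> g y \<le> g x)"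
    and mu: "\<bar>g a\<bar> \<le> m" "\<bar>g b\<bar> \<le> m"
  shows "\<bar>integral {a..b} (\<lambda>x. g x * f x)\<bar> \<le> 4 * m"
proof -
  have hi: "(f has_integral F d - F c) {c..d}" if "a \<le> c" "c \<le> d" "d \<le> b" for c d
    using that
    by (intro fundamental_theorem_of_calculus)
       (auto simp: has_real_derivative_iff_has_vector_derivative[symmetric] intro!: DERIV_subset[OF F])
  have int: "f integrable_on {a..b}" using hi[of a b] ab by blast
  have main: "\<bar>integral {a..b} (\<lambda>x. G x * f x)\<bar> \<le> 4 * m"
    if G: "\<And>x y. a \<le> x \<Longrightarrow> x \<le> y \<Longrightarrow> y \<le> b \<Longrightarrow> G x \<le> G y" and m: "\<bar>G a\<bar> \<le> m" "\<bar>G b\<bar> \<le> m" for G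
  proof -
    obtain c where c: "c \<in> {a..b}"
      and e: "integral {a..b} (\<lambda>x. G x * f x) = G a * integral {a..c} f + G b * integral {c..b} f"
      using second_mean_value_theorem[OF int ab, of G] G by blast
    have "integral {a..c} f = F c - F a" "integral {c..b} f = F b - F c"
      using c hi[of a c] hi[of c b] by (auto intro: integral_unique)
    moreover have "\<bar>F c - F a\<bar> \<le> 2" "\<bar>F b - F c\<bar> \<le> 2"
      using bd[of a] bd[of b] bd[of c] c by auto
    ultimately have "\<bar>G a * integral {a..c} f\<bar> \<le> m * 2" "\<bar>G b * integral {c..b} f\<bar> \<le> m * 2"
      using m by (auto simp: abs_mult intro!: mult_mono)
    then show ?thesis unfolding e by linarith
  qed
  show ?thesis using g
  proof
    assume "\<forall>x y. a \<le> x \<and> x \<le> y \<and> y \<le> b \<longrightarrow> g x \<le> g y"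
    then show ?thesis using main[of g] mu by blast
  next
    assume "\<forall>x y. a \<le> x \<and> x \<le> y \<and> y \<le> b \<longrightarrow> g y \<le> g x"
    then show ?thesis using main[of "\<lambda>x. - g x"] mu by simp
  qed
qed

lemma integral_eq_cnj:
  assumes "f integrable_on S" "\<And>x. x \<in> S \<Longrightarrow> h x = cnj (f x)"
  shows "integral S h = cnj (integral S f)"
proof -
  have "((\<lambda>x. cnj (f x)) has_integral cnj (integral S f)) S"
    using has_integral_cnj[of f "integral S f" S] assms(1) by (simp add: has_integral_iff o_def)
  then show ?thesis using assms(2) has_integral_cong integral_unique by metis
qed

text \<open>Changing the sign of the phase conjugates the integral. This reduces negative curvature
  to positive curvature and negative time to positive time.\<close>

lemma norm_integral_cis_minus:
  fixes p q :: "real \<Rightarrow> real"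
  assumes "continuous_on {a..b} p" "\<And>x. x \<in> {a..b} \<Longrightarrow> q x = - p x"
  shows "norm (integral {a..b} (\<lambda>x. cis (q x))) = norm (integral {a..b} (\<lambda>x. cis (p x)))"
proof -
  have "integral {a..b} (\<lambda>x. cis (q x)) = cnj (integral {a..b} (\<lambda>x. cis (p x)))"
  proof (rule integral_eq_cnj)
    show "(\<lambda>x. cis (p x)) integrable_on {a..b}"
      by (intro integrable_continuous_real continuous_intros assms)
  qed (simp add: assms cis_cnj)
  then show ?thesis by simp
qed

lemma norm_integral_cis_le:
  fixes p :: "real \<Rightarrow> real"
  assumes "continuous_on {a..b} p" "a \<le> b"
  shows "norm (integral {a..b} (\<lambda>x. cis (p x))) \<le> b - a"
  using integral_bound[of a b "\<lambda>x. cis (p x)" 1] assms by (auto intro!: continuous_intros)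

text \<open>
  The second mean value theorem, applied to the monotone function \<open>1 / psi'\<close>, takes the place of the
  usual integration by parts, so that no second derivative is needed.
\<close>

lemma van_der_corput_first:
  fixes psi psi' :: "real \<Rightarrow> real"
  assumes ab: "a \<le> b"
    and der: "\<And>x. x \<in> {a..b} \<Longrightarrow> (psi has_real_derivative psi' x) (at x within {a..b})"
    and mono: "(\<forall>x y. a \<le> x \<and> x \<le> y \<and> y \<le> b \<longrightarrow> psi' x \<le> psi' y) \<or>
               (\<forall>x y. a \<le> x \<and> x \<le> y \<and> y \<le> b \<longrightarrow> psi' y \<le> psi' x)"
    and mu: "0 < m" "\<And>x. x \<in> {a..b} \<Longrightarrow> m \<le> psi' x"
  shows "norm (integral {a..b} (\<lambda>x. cis (psi x))) \<le> 8 / m"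
proof -
  have cont: "continuous_on {a..b} psi"
    using der DERIV_continuous continuous_on_eq_continuous_within by blast
  have int: "(\<lambda>x. cis (psi x)) integrable_on {a..b}"
    by (intro integrable_continuous_real continuous_intros cont)
  have pos: "psi' x > 0" if "x \<in> {a..b}" for x using mu that by force
  have g: "(\<forall>x y. a \<le> x \<and> x \<le> y \<and> y \<le> b \<longrightarrow> 1 / psi' x \<le> 1 / psi' y) \<or>
           (\<forall>x y. a \<le> x \<and> x \<le> y \<and> y \<le> b \<longrightarrow> 1 / psi' y \<le> 1 / psi' x)"
    using mono pos by (auto intro!: divide_left_mono mult_pos_pos)
  have m: "\<bar>1 / psi' a\<bar> \<le> 1 / m" "\<bar>1 / psi' b\<bar> \<le> 1 / m"
    using mu ab pos[of a] pos[of b] by (auto intro!: divide_left_mono)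
  \<comment> \<open>The real part integrates \<open>1 / psi'\<close> against the derivative of
    \<open>sin psi\<close>, the imaginary part below against that of \<open>- cos psi\<close>. The
    two bounds \<open>4 / m\<close> add up to \<open>8 / m\<close>.\<close>
  have "\<bar>integral {a..b} (\<lambda>x. 1 / psi' x * (cos (psi x) * psi' x))\<bar> \<le> 4 * (1 / m)"
    by (rule integral_monotone_mult_derivative_bound[where F="\<lambda>x. sin (psi x)"])
       (use ab g m in \<open>auto intro!: derivative_eq_intros der\<close>)
  also have "integral {a..b} (\<lambda>x. 1 / psi' x * (cos (psi x) * psi' x)) = integral {a..b} (\<lambda>x. cos (psi x))"
    using pos by (intro integral_cong) force
  also have "\<dots> = Re (integral {a..b} (\<lambda>x. cis (psi x)))"
    using integral_linear[OF int bounded_linear_Re] by (simp add: o_def)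
  finally have 1: "\<bar>Re (integral {a..b} (\<lambda>x. cis (psi x)))\<bar> \<le> 4 / m" by simp
  have "\<bar>integral {a..b} (\<lambda>x. 1 / psi' x * (sin (psi x) * psi' x))\<bar> \<le> 4 * (1 / m)"
    by (rule integral_monotone_mult_derivative_bound[where F="\<lambda>x. - cos (psi x)"])
       (use ab g m in \<open>auto intro!: derivative_eq_intros der\<close>)
  also have "integral {a..b} (\<lambda>x. 1 / psi' x * (sin (psi x) * psi' x)) = integral {a..b} (\<lambda>x. sin (psi x))"
    using pos by (intro integral_cong) force
  also have "\<dots> = Im (integral {a..b} (\<lambda>x. cis (psi x)))"
    using integral_linear[OF int bounded_linear_Im] by (simp add: o_def)
  finally have 2: "\<bar>Im (integral {a..b} (\<lambda>x. cis (psi x)))\<bar> \<le> 4 / m" by simp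
  have "norm (integral {a..b} (\<lambda>x. cis (psi x))) \<le> 4 / m + 4 / m"
    using cmod_le[of "integral {a..b} (\<lambda>x. cis (psi x))"] 1 2 by linarith
  then show ?thesis by simp
qed

text \<open>Since \<open>psi' a \<ge> 0\<close>, the growth of \<open>psi'\<close> gives
  \<open>psi' x \<ge> l (x - a)\<close>. The piece within distance \<open>d\<close> of
  \<open>a\<close> is bounded by its length, and the first derivative test with
  \<open>m = l d\<close> bounds the rest by \<open>8 / (l d)\<close>. The choice
  \<open>d = 1 / sqrt l\<close> makes both of order \<open>1 / sqrt l\<close>.\<close>

lemma van_der_corput_second_right:
  fixes psi psi' :: "real \<Rightarrow> real"
  assumes ab: "a \<le> b"
    and der: "\<And>x. x \<in> {a..b} \<Longrightarrow> (psi has_real_derivative psi' x) (at x within {a..b})"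
    and lam: "0 < l"
    and incr: "\<And>x y. a \<le> x \<Longrightarrow> x \<le> y \<Longrightarrow> y \<le> b \<Longrightarrow> psi' y - psi' x \<ge> l * (y - x)"
    and pos: "psi' a \<ge> 0"
  shows "norm (integral {a..b} (\<lambda>x. cis (psi x))) \<le> 9 / sqrt l"
proof -
  have cont: "continuous_on {a..b} psi"
    using der DERIV_continuous continuous_on_eq_continuous_within by blast
  define d where "d = 1 / sqrt l"
  have d: "d > 0" using lam by (simp add: d_def)
  show ?thesis
  proof (cases "b - a \<le> d")
    case True
    then have "norm (integral {a..b} (\<lambda>x. cis (psi x))) \<le> d"
      using norm_integral_cis_le[OF cont ab] by simp
    also have "\<dots> \<le> 9 / sqrt l" unfolding d_def using lam by (simp add: divide_right_mono)
    finally show ?thesis .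
  next
    case False
    have "integral {a..b} (\<lambda>x. cis (psi x)) =
          integral {a..a+d} (\<lambda>x. cis (psi x)) + integral {a+d..b} (\<lambda>x. cis (psi x))"
      using False d
      by (intro Henstock_Kurzweil_Integration.integral_combine[symmetric] integrable_continuous_real continuous_intros cont) auto
    moreover have "norm (integral {a..a+d} (\<lambda>x. cis (psi x))) \<le> d"
      using norm_integral_cis_le[of a "a+d" psi] continuous_on_subset[OF cont] False d by auto
    moreover have "norm (integral {a+d..b} (\<lambda>x. cis (psi x))) \<le> 8 / (l * d)"
    proof (rule van_der_corput_first)
      show "(psi has_real_derivative psi' x) (at x within {a + d..b})" if "x \<in> {a+d..b}" for x
        using that d by (intro DERIV_subset[OF der]) auto
      have "psi' x \<le> psi' y" if "a + d \<le> x" "x \<le> y" "y \<le> b" for x y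
      proof -
        have "0 \<le> l * (y - x)" using that lam by simp
        then show ?thesis using incr[of x y] that d by linarith
      qed
      then show "(\<forall>x y. a+d \<le> x \<and> x \<le> y \<and> y \<le> b \<longrightarrow> psi' x \<le> psi' y) \<or>
               (\<forall>x y. a+d \<le> x \<and> x \<le> y \<and> y \<le> b \<longrightarrow> psi' y \<le> psi' x)" by blast
      show "l * d \<le> psi' x" if "x \<in> {a+d..b}" for x
      proof -
        have "l * d \<le> l * (x - a)" using that lam by auto
        then show ?thesis using incr[of a x] that d pos by auto
      qed
    qed (use False d lam in auto)
    moreover have "8 / (l * d) = 8 / sqrt l"
      using lam by (simp add: d_def real_div_sqrt)
    ultimately have "norm (integral {a..b} (\<lambda>x. cis (psi x))) \<le> d + 8 / sqrt l"
      by (smt (verit) norm_triangle_ineq)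
    also have "\<dots> = 9 / sqrt l" using add_divide_distrib[of 1 8 "sqrt l"] by (simp add: d_def)
    finally show ?thesis .
  qed
qed

text \<open>The reflection \<open>x \<mapsto> - x\<close> maps this to the previous case and
  preserves the growth condition on the derivative.\<close>

lemma van_der_corput_second_left:
  fixes psi psi' :: "real \<Rightarrow> real"
  assumes ab: "a \<le> b"
    and der: "\<And>x. x \<in> {a..b} \<Longrightarrow> (psi has_real_derivative psi' x) (at x within {a..b})"
    and lam: "0 < l"
    and incr: "\<And>x y. a \<le> x \<Longrightarrow> x \<le> y \<Longrightarrow> y \<le> b \<Longrightarrow> psi' y - psi' x \<ge> l * (y - x)"
    and neg: "psi' b \<le> 0"
  shows "norm (integral {a..b} (\<lambda>x. cis (psi x))) \<le> 9 / sqrt l"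
proof -
  have "norm (integral {-b..-a} (\<lambda>x. cis (psi (- x)))) \<le> 9 / sqrt l"
  proof (rule van_der_corput_second_right)
    fix x assume x: "x \<in> {-b..-a}"
    have "(psi has_real_derivative psi' (- x)) (at (- x) within uminus ` {-b..-a})"
      using der[of "-x"] x by simp
    moreover have "(uminus has_real_derivative -1) (at x within {-b..-a})"
      by (auto intro!: derivative_eq_intros)
    ultimately have "((psi \<circ> uminus) has_real_derivative psi' (- x) * -1) (at x within {-b..-a})"
      by (rule DERIV_image_chain)
    then show "((\<lambda>x. psi (- x)) has_real_derivative - psi' (- x)) (at x within {-b..-a})"
      by (simp only: o_def mult_minus1_right)
  next
    fix x y assume "-b \<le> x" "x \<le> y" "y \<le> -a"
    then show "- psi' (- y) - - psi' (- x) \<ge> l * (y - x)" using incr[of "-y" "-x"] by simp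
  qed (use ab lam neg in simp_all)
  then show ?thesis
    using Henstock_Kurzweil_Integration.integral_reflect_real[of b a "\<lambda>x. cis (psi x)"] by simp
qed

text \<open>If \<open>psi'\<close> changes sign, the interval is cut at a zero of
  \<open>psi'\<close> and the one-sided bounds apply on either side, whence the factor 2. The
  curvature enters only through increments of \<open>psi'\<close>.\<close>

lemma van_der_corput_second:
  fixes psi psi' :: "real \<Rightarrow> real"
  assumes ab: "a \<le> b"
    and der: "\<And>x. x \<in> {a..b} \<Longrightarrow> (psi has_real_derivative psi' x) (at x within {a..b})"
    and cont': "continuous_on {a..b} psi'"
    and lam: "0 < l"
    and incr: "\<And>x y. a \<le> x \<Longrightarrow> x \<le> y \<Longrightarrow> y \<le> b \<Longrightarrow> psi' y - psi' x \<ge> l * (y - x)"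
  shows "norm (integral {a..b} (\<lambda>x. cis (psi x))) \<le> 18 / sqrt l"
proof -
  have cont: "continuous_on {a..b} psi"
    using der DERIV_continuous continuous_on_eq_continuous_within by blast
  have le: "9 / sqrt l \<le> 18 / sqrt l" using lam by (simp add: divide_right_mono)
  consider "psi' a \<ge> 0" | "psi' b \<le> 0" | "psi' a \<le> 0" "psi' b \<ge> 0" by linarith
  then show ?thesis
  proof cases
    case 1
    then show ?thesis using van_der_corput_second_right[OF ab der lam incr] le by force
  next
    case 2
    then show ?thesis using van_der_corput_second_left[OF ab der lam incr] le by force
  next
    case 3
    then obtain c where c: "a \<le> c" "c \<le> b" "psi' c = 0" using IVT'[OF 3 ab cont'] by auto
    have "integral {a..b} (\<lambda>x. cis (psi x)) =
          integral {a..c} (\<lambda>x. cis (psi x)) + integral {c..b} (\<lambda>x. cis (psi x))"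
      using c
      by (intro Henstock_Kurzweil_Integration.integral_combine[symmetric] integrable_continuous_real continuous_intros cont) auto
    moreover have "norm (integral {a..c} (\<lambda>x. cis (psi x))) \<le> 9 / sqrt l"
    proof (rule van_der_corput_second_left[where psi'=psi'])
      show "(psi has_real_derivative psi' x) (at x within {a..c})" if "x \<in> {a..c}" for x
        by (rule DERIV_subset[OF der]) (use that c in auto)
      show "l * (y - x) \<le> psi' y - psi' x" if "a \<le> x" "x \<le> y" "y \<le> c" for x y
        by (rule incr) (use that c in linarith)+
    qed (use c lam in simp_all)
    moreover have "norm (integral {c..b} (\<lambda>x. cis (psi x))) \<le> 9 / sqrt l"
    proof (rule van_der_corput_second_right[where psi'=psi'])
      show "(psi has_real_derivative psi' x) (at x within {c..b})" if "x \<in> {c..b}" for x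
        by (rule DERIV_subset[OF der]) (use that c in auto)
      show "l * (y - x) \<le> psi' y - psi' x" if "c \<le> x" "x \<le> y" "y \<le> b" for x y
        by (rule incr) (use that c in linarith)+
    qed (use c lam in simp_all)
    ultimately have "norm (integral {a..b} (\<lambda>x. cis (psi x))) \<le> 9 / sqrt l + 9 / sqrt l"
      by (smt (verit) norm_triangle_ineq)
    then show ?thesis by simp
  qed
qed

section \<open>The flow as a Fourier multiplier\<close>

text \<open>The Weierstrass M-test makes the finite partial sums converge uniformly, so that
  integration can be done term by term and continuity survives the limit.\<close>

lemma integral_infsum:
  fixes f :: "'a \<Rightarrow> real \<Rightarrow> complex"
  assumes cont: "\<And>j. j \<in> X \<Longrightarrow> continuous_on {a..b} (f j)"
    and bd: "\<And>j x. j \<in> X \<Longrightarrow> x \<in> {a..b} \<Longrightarrow> norm (f j x) \<le> M j"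
    and M: "M summable_on X"
  shows "((\<lambda>j. integral {a..b} (f j)) has_sum integral {a..b} (\<lambda>x. \<Sum>\<^sub>\<infinity>j\<in>X. f j x)) X"
    and "continuous_on {a..b} (\<lambda>x. \<Sum>\<^sub>\<infinity>j\<in>X. f j x)"
proof -
  \<comment> \<open>Terms outside \<open>X\<close> are replaced by zero so that the sum over every
    index set \<open>S\<close>, not only over subsets of \<open>X\<close>, is continuous.\<close>
  define F where "F = (\<lambda>j. if j \<in> X then f j else (\<lambda>x. 0))"
  have contF: "continuous_on {a..b} (F j)" for j using cont by (simp add: F_def)
  have "uniform_limit {a..b} (\<lambda>S x. \<Sum>j\<in>S. F j x) (\<lambda>x. \<Sum>\<^sub>\<infinity>j\<in>X. F j x) (finite_subsets_at_top X)"
    by (rule Weierstrass_m_test_general[OF _ M]) (auto simp: F_def bd)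
  also have "(\<lambda>x. \<Sum>\<^sub>\<infinity>j\<in>X. F j x) = (\<lambda>x. \<Sum>\<^sub>\<infinity>j\<in>X. f j x)"
    by (intro ext infsum_cong) (simp add: F_def)
  finally have ul: "uniform_limit {a..b} (\<lambda>S x. \<Sum>j\<in>S. F j x) (\<lambda>x. \<Sum>\<^sub>\<infinity>j\<in>X. f j x) (finite_subsets_at_top X)" .
  have c: "continuous_on {a..b} (\<lambda>x. \<Sum>j\<in>S. F j x)" for S
    by (intro continuous_intros contF)
  from uniform_limit_theorem[OF _ ul] c
  show "continuous_on {a..b} (\<lambda>x. \<Sum>\<^sub>\<infinity>j\<in>X. f j x)" by simp
  obtain I K where I: "\<And>S. ((\<lambda>x. \<Sum>j\<in>S. F j x) has_integral I S) {a..b}"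
    and K: "((\<lambda>x. \<Sum>\<^sub>\<infinity>j\<in>X. f j x) has_integral K) {a..b}"
    and lim: "(I \<longlongrightarrow> K) (finite_subsets_at_top X)"
    using uniform_limit_integral[OF ul c] by (metis finite_subsets_at_top_neq_bot)
  have "I S = (\<Sum>j\<in>S. integral {a..b} (F j))" if "finite S" for S
    using integral_unique[OF I[of S]] that contF
    by (simp add: Henstock_Kurzweil_Integration.integral_sum integrable_continuous_real)
  moreover have "(\<Sum>j\<in>S. integral {a..b} (F j)) = (\<Sum>j\<in>S. integral {a..b} (f j))" if "S \<subseteq> X" for S
    using that by (intro sum.cong) (auto simp: F_def)
  ultimately have "eventually (\<lambda>S. I S = (\<Sum>j\<in>S. integral {a..b} (f j))) (finite_subsets_at_top X)"
    by (intro eventually_finite_subsets_at_top_weakI) auto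
  with lim have "((\<lambda>S. \<Sum>j\<in>S. integral {a..b} (f j)) \<longlongrightarrow> K) (finite_subsets_at_top X)"
    using tendsto_cong by fastforce
  then show "((\<lambda>j. integral {a..b} (f j)) has_sum integral {a..b} (\<lambda>x. \<Sum>\<^sub>\<infinity>j\<in>X. f j x)) X"
    using K by (simp add: has_sum_def integral_unique)
qed

section \<open>Fourier coefficients of continuous functions and Bessel's inequality\<close>

definition fourier_coeff :: "(real \<Rightarrow> complex) \<Rightarrow> int \<Rightarrow> complex" where
  "fourier_coeff g n = integral {-pi..pi} (\<lambda>x. cis (of_int n * x) * g x) / of_real (2 * pi)"

lemma integrable_cis_mult:
  assumes "continuous_on {a..b} g"
  shows "(\<lambda>x. cis (c * x) * g x) integrable_on {a..b}"
  by (intro integrable_continuous_real continuous_intros assms)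

lemma fourier_coeff_diff:
  assumes "continuous_on {-pi..pi} g" "continuous_on {-pi..pi} h"
  shows "fourier_coeff (\<lambda>x. g x - h x) n = fourier_coeff g n - fourier_coeff h n"
  unfolding fourier_coeff_def right_diff_distrib diff_divide_distrib[symmetric]
  by (subst Henstock_Kurzweil_Integration.integral_diff) (auto intro!: assms integrable_cis_mult)

lemma fourier_coeff_sum:
  assumes "finite A" "\<And>k. k \<in> A \<Longrightarrow> continuous_on {-pi..pi} (g k)"
  shows "fourier_coeff (\<lambda>x. \<Sum>k\<in>A. g k x) n = (\<Sum>k\<in>A. fourier_coeff (g k) n)"
  unfolding fourier_coeff_def sum_distrib_left sum_divide_distrib[symmetric]
  by (subst Henstock_Kurzweil_Integration.integral_sum) (auto intro!: assms integrable_cis_mult)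

lemma fourier_coeff_cmult:
  "fourier_coeff (\<lambda>x. c * g x) n = c * fourier_coeff g n"
proof -
  have "(\<lambda>x. cis (of_int n * x) * (c * g x)) = (\<lambda>x. c * (cis (of_int n * x) * g x))"
    by (simp add: algebra_simps)
  then show ?thesis unfolding fourier_coeff_def by simp
qed

lemma integral_cis_int:
  "integral {-pi..pi} (\<lambda>x. cis (of_int n * x)) = (if n = 0 then of_real (2 * pi) else 0)"
proof (cases "n = 0")
  case False
  have "((\<lambda>x. cis (of_int n * x)) has_integral
      (cis (of_int n * pi) / (\<i> * of_int n) - cis (of_int n * (- pi)) / (\<i> * of_int n))) {-pi..pi}"
    using False
    by (intro fundamental_theorem_of_calculus)
       (auto simp: cis_conv_exp field_simps intro!: derivative_eq_intros has_vector_derivative_real_field)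
  moreover have "cis (of_int n * pi) = cis (of_int n * (- pi))"
    by (simp add: complex_eq_iff)
       (metis mult.commute sin_npi_int minus_zero)
  ultimately show ?thesis using False by (simp add: integral_unique)
qed (simp add: scaleR_conv_of_real)

text \<open>With the sign of the kernel \<open>K\<^sub>t\<close> in \<open>fourier_coeff\<close>,
  the exponential dual to index \<open>m\<close> is \<open>cis (- (m x))\<close>. Hence the minus
  signs in all series below.\<close>

lemma fourier_coeff_cis:
  "fourier_coeff (\<lambda>x. cis (- (of_int m * x))) n = (if n = m then 1 else 0)"
proof -
  have "(\<lambda>x. cis (of_int n * x) * cis (- (of_int m * x))) = (\<lambda>x. cis (of_int (n - m) * x))"
    by (simp add: cis_mult algebra_simps)
  then show ?thesis unfolding fourier_coeff_def using integral_cis_int[of "n - m"] by simp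
qed

text \<open>The partial Fourier sum \<open>h\<close> has the same coefficients as \<open>g\<close>
  on \<open>F\<close>, so \<open>g - h\<close> is orthogonal to \<open>h\<close>, and the integral
  of the squared modulus of \<open>h\<close> is \<open>2 pi\<close> times the sum in
  question.\<close>

lemma bessel_inequality_finite:
  assumes g: "continuous_on {-pi..pi} g" and B: "\<And>x. x \<in> {-pi..pi} \<Longrightarrow> norm (g x) \<le> B"
    and F: "finite F"
  shows "(\<Sum>n\<in>F. (norm (fourier_coeff g n))\<^sup>2) \<le> B\<^sup>2"
proof -
  define c where "c = fourier_coeff g"
  define h where "h = (\<lambda>x. \<Sum>n\<in>F. c n * cis (- (of_int n * x)))"
  have ch: "continuous_on {-pi..pi} h" unfolding h_def by (intro continuous_intros)
  have coef_h: "fourier_coeff h n = c n" if "n \<in> F" for n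
    unfolding h_def using F that
    by (subst fourier_coeff_sum)
       (auto simp: fourier_coeff_cmult fourier_coeff_cis if_distrib[of "(*) _"] sum.delta' intro!: continuous_intros cong: if_cong)
  have inner: "integral {-pi..pi} (\<lambda>x. q x * cnj (h x)) = of_real (2 * pi) * (\<Sum>n\<in>F. cnj (c n) * fourier_coeff q n)"
    if q: "continuous_on {-pi..pi} q" for q
  proof -
    have "(\<lambda>x. q x * cnj (h x)) = (\<lambda>x. \<Sum>n\<in>F. cnj (c n) * (cis (of_int n * x) * q x))"
      by (simp add: h_def sum_distrib_left cis_cnj algebra_simps)
    then have "integral {-pi..pi} (\<lambda>x. q x * cnj (h x)) =
        (\<Sum>n\<in>F. cnj (c n) * integral {-pi..pi} (\<lambda>x. cis (of_int n * x) * q x))"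
      using F by (simp only:, subst Henstock_Kurzweil_Integration.integral_sum)
        (auto intro!: integrable_continuous_real continuous_intros q)
    then show ?thesis by (simp add: fourier_coeff_def sum_distrib_left)
  qed
  have z: "integral {-pi..pi} (\<lambda>x. (g x - h x) * cnj (h x)) = 0"
    using coef_h by (subst inner)
      (auto simp: fourier_coeff_diff g ch c_def intro!: continuous_intros g ch)
  have hh: "integral {-pi..pi} (\<lambda>x. h x * cnj (h x)) = of_real (2 * pi * (\<Sum>n\<in>F. (norm (c n))\<^sup>2))"
    using coef_h by (subst inner[OF ch])
      (auto simp: complex_norm_square[unfolded of_real_power] mult.commute intro!: sum.cong)
  \<comment> \<open>Twice the vanishing cross term is added because the integrand then has real part
    \<open>(norm (g x))\<^sup>2 - (norm (g x - h x))\<^sup>2\<close>, which is at most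
    \<open>B\<^sup>2\<close> pointwise.\<close>
  have "2 * pi * (\<Sum>n\<in>F. (norm (c n))\<^sup>2) = integral {-pi..pi} (\<lambda>x. Re (h x * cnj (h x) + 2 * ((g x - h x) * cnj (h x))))"
  proof -
    have "integral {-pi..pi} (\<lambda>x. h x * cnj (h x) + 2 * ((g x - h x) * cnj (h x))) = of_real (2 * pi * (\<Sum>n\<in>F. (norm (c n))\<^sup>2))"
      by (subst Henstock_Kurzweil_Integration.integral_add)
         (auto intro!: integrable_continuous_real continuous_intros g ch simp: z hh)
    moreover have "(\<lambda>x. h x * cnj (h x) + 2 * ((g x - h x) * cnj (h x))) integrable_on {-pi..pi}"
      by (intro integrable_continuous_real continuous_intros g ch)
    ultimately show ?thesis
      using integral_linear[of "\<lambda>x. h x * cnj (h x) + 2 * ((g x - h x) * cnj (h x))" "{-pi..pi}" Re]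
      by (simp add: o_def bounded_linear_Re)
  qed
  also have "\<dots> \<le> integral {-pi..pi} (\<lambda>x. B\<^sup>2)"
  proof (rule integral_le)
    fix x assume x: "x \<in> {-pi..pi}"
    have "Re (h x * cnj (h x) + 2 * ((g x - h x) * cnj (h x))) = (norm (g x))\<^sup>2 - (norm (g x - h x))\<^sup>2"
      unfolding cmod_power2 by (simp add: power2_eq_square algebra_simps)
    also have "\<dots> \<le> (norm (g x))\<^sup>2" by simp
    also have "\<dots> \<le> B\<^sup>2" using B[OF x] by (intro power_mono) auto
    finally show "Re (h x * cnj (h x) + 2 * ((g x - h x) * cnj (h x))) \<le> B\<^sup>2" .
  qed (auto intro!: integrable_continuous_real continuous_intros g ch)
  also have "\<dots> = 2 * pi * B\<^sup>2" by simp
  finally show ?thesis by (simp add: c_def)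
qed

text \<open>Through this bound, uniform convergence of multipliers becomes convergence of
  coefficients in \<open>l2\<close>, the sense in which \<open>linear_flow\<close> is
  defined.\<close>

lemma bessel_inequality:
  assumes g: "continuous_on {-pi..pi} g" and B: "\<And>x. x \<in> {-pi..pi} \<Longrightarrow> norm (g x) \<le> B"
  shows "fourier_coeff g \<in> l2" "l2_norm (fourier_coeff g) \<le> B"
proof -
  have B0: "B \<ge> 0" using order_trans[OF norm_ge_zero B[of 0]] by simp
  have fin: "(\<Sum>n\<in>F. (norm (fourier_coeff g n))\<^sup>2) \<le> B\<^sup>2" if "finite F" for F
    by (rule bessel_inequality_finite[OF g B that])
  have s: "(\<lambda>n. (norm (fourier_coeff g n))\<^sup>2) summable_on UNIV"
    by (rule nonneg_bounded_partial_sums_imp_summable_on[where C="B\<^sup>2"])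
       (auto intro!: eventually_finite_subsets_at_top_weakI fin)
  then show "fourier_coeff g \<in> l2" by (simp add: l2_def)
  have "(\<Sum>\<^sub>\<infinity>n. (norm (fourier_coeff g n))\<^sup>2) \<le> B\<^sup>2"
    by (rule infsum_le_finite_sums[OF s fin])
  then show "l2_norm (fourier_coeff g) \<le> B"
    unfolding l2_norm_def by (intro real_le_lsqrt B0)
qed

text \<open>This is the Fourier multiplier of \<open>lattice_op J\<close>. It is complex valued for
  a general \<open>J\<close>; for an even coupling the terms at \<open>j\<close> and
  \<open>- j\<close> combine to cosines.\<close>

definition symbol :: "(int \<Rightarrow> real) \<Rightarrow> real \<Rightarrow> complex" where
  "symbol J x = (\<Sum>\<^sub>\<infinity>j\<in>UNIV - {0}. of_real (J j) * (1 - cis (- (of_int j * x))))"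

lemma norm_one_minus_cis_le: "norm (1 - cis x) \<le> 2"
  using norm_triangle_ineq4[of 1 "cis x"] by simp

lemma continuous_on_symbol:
  assumes "(\<lambda>j. \<bar>J j\<bar>) summable_on UNIV"
  shows "continuous_on {-pi..pi} (symbol J)"
proof -
  have M: "(\<lambda>j. \<bar>J j\<bar> * 2) summable_on UNIV - {0}"
    using assms by (intro summable_on_cmult_left) (rule summable_on_subset_banach, auto)
  have "continuous_on {-pi..pi} (\<lambda>x. \<Sum>\<^sub>\<infinity>j\<in>UNIV-{0}. of_real (J j) * (1 - cis (- (of_int j * x))))"
    by (rule integral_infsum(2)[OF _ _ M])
       (auto intro!: continuous_intros simp: norm_mult mult_left_mono norm_one_minus_cis_le)
  then show ?thesis by (simp add: symbol_def[abs_def])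
qed

lemma continuous_on_bounded_Icc:
  fixes g :: "real \<Rightarrow> complex"
  assumes "continuous_on {a..b} g"
  obtains G where "\<And>x. x \<in> {a..b} \<Longrightarrow> norm (g x) \<le> G" "G > 0"
  using compact_imp_bounded[OF compact_continuous_image[OF assms compact_Icc]]
  unfolding bounded_pos by (metis image_eqI)

text \<open>With \<open>j = n - m\<close>, the difference of the coefficients at \<open>n\<close>
  and \<open>m\<close> is the \<open>n\<close>-th coefficient of
  \<open>(1 - cis (- (j x))) * g x\<close>. Summability of \<open>J\<close> allows the sum over
  \<open>j\<close> to be taken under the integral, where it becomes the symbol.\<close>

lemma lattice_op_fourier_coeff:
  assumes J: "(\<lambda>j. \<bar>J j\<bar>) summable_on UNIV" and g: "continuous_on {-pi..pi} g"
  shows "lattice_op J (fourier_coeff g) = fourier_coeff (\<lambda>x. symbol J x * g x)"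
proof
  fix n
  obtain G where G: "\<And>x. x \<in> {-pi..pi} \<Longrightarrow> norm (g x) \<le> G"
    using continuous_on_bounded_Icc[OF g] by blast
  define f where "f = (\<lambda>j x. of_real (J j) * (1 - cis (- (of_int j * x))) * (cis (of_int n * x) * g x))"
  have M: "(\<lambda>j. \<bar>J j\<bar> * (2 * G)) summable_on UNIV - {0}"
    using J by (intro summable_on_cmult_left) (rule summable_on_subset_banach, auto)
  have hs: "((\<lambda>j. integral {-pi..pi} (f j)) has_sum integral {-pi..pi} (\<lambda>x. \<Sum>\<^sub>\<infinity>j\<in>UNIV-{0}. f j x)) (UNIV-{0})"
  proof (rule integral_infsum(1)[OF _ _ M])
    show "continuous_on {-pi..pi} (f j)" for j unfolding f_def by (intro continuous_intros g)
    show "norm (f j x) \<le> \<bar>J j\<bar> * (2 * G)" if "x \<in> {-pi..pi}" for j x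
      using G[OF that] norm_one_minus_cis_le[of "- (of_int j * x)"]
      by (auto simp: f_def norm_mult mult.assoc intro!: mult_left_mono mult_mono)
  qed
  have "lattice_op J (fourier_coeff g) n = (\<Sum>\<^sub>\<infinity>j\<in>UNIV-{0}. integral {-pi..pi} (f j) / of_real (2*pi))"
    unfolding lattice_op_def
  proof (rule infsum_reindex_bij_witness[where i="\<lambda>j. n - j" and j="\<lambda>m. n - m"])
    fix m assume "m \<in> UNIV - {n}"
    have "cis (of_int n * x) * cis (- (of_int (n - m) * x)) = cis (of_int m * x)" for x
      by (simp add: cis_mult algebra_simps)
    then have "(1 - cis (- (of_int (n - m) * x))) * (cis (of_int n * x) * g x) = cis (of_int n * x) * g x - cis (of_int m * x) * g x" for x
      unfolding left_diff_distrib mult.assoc[symmetric] mult_1 by (simp only: mult.commute[of "cis (- _)"])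
    then have "f (n - m) = (\<lambda>x. of_real (J (n - m)) * (cis (of_int n * x) * g x - cis (of_int m * x) * g x))"
      by (simp only: f_def mult.assoc)
    then show "integral {-pi..pi} (f (n - m)) / of_real (2*pi) = of_real (J (n - m)) * (fourier_coeff g n - fourier_coeff g m)"
      by (simp add: fourier_coeff_def Henstock_Kurzweil_Integration.integral_diff integrable_cis_mult[OF g] flip: diff_divide_distrib)
  qed auto
  also have "\<dots> = integral {-pi..pi} (\<lambda>x. \<Sum>\<^sub>\<infinity>j\<in>UNIV-{0}. f j x) / of_real (2*pi)"
    unfolding divide_inverse using has_sum_cmult_left[OF hs] infsumI by blast
  also have "(\<lambda>x. \<Sum>\<^sub>\<infinity>j\<in>UNIV-{0}. f j x) = (\<lambda>x. cis (of_int n * x) * (symbol J x * g x))"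
    unfolding f_def symbol_def infsum_cmult_left' by (simp add: algebra_simps)
  finally show "lattice_op J (fourier_coeff g) n = fourier_coeff (\<lambda>x. symbol J x * g x) n"
    by (simp only: fourier_coeff_def[of "\<lambda>x. symbol J x * g x"])
qed

lemma lattice_op_funpow_fourier_coeff:
  assumes J: "(\<lambda>j. \<bar>J j\<bar>) summable_on UNIV" and g: "continuous_on {-pi..pi} g"
  shows "(lattice_op J ^^ k) (fourier_coeff g) = fourier_coeff (\<lambda>x. symbol J x ^ k * g x)"
proof (induction k)
  case (Suc k)
  then show ?case
    using lattice_op_fourier_coeff[OF J, of "\<lambda>x. symbol J x ^ k * g x"]
    by (simp add: continuous_intros continuous_on_symbol[OF J] g mult.assoc)
qed simp

text \<open>The series for \<open>g\<close> converges absolutely and uniformly, so it can be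
  integrated term by term against \<open>E\<close>. This turns multiplication by \<open>E\<close>
  into convolution with its coefficients, and \<open>E = 1\<close> gives the inversion
  formula.\<close>

lemma fourier_inversion_l1:
  assumes "\<phi> \<in> l1"
  defines "g \<equiv> \<lambda>x. \<Sum>\<^sub>\<infinity>m. \<phi> m * cis (- (of_int m * x))"
  shows "continuous_on {-pi..pi} g" "fourier_coeff g = \<phi>"
    and "\<And>E n. continuous_on {-pi..pi} E \<Longrightarrow>
      ((\<lambda>m. \<phi> m * fourier_coeff E (n - m)) has_sum fourier_coeff (\<lambda>x. E x * g x) n) UNIV"
proof -
  have M: "(\<lambda>m. norm (\<phi> m)) summable_on UNIV" using assms by (simp add: l1_def)
  show "continuous_on {-pi..pi} g" unfolding g_def
    by (rule integral_infsum(2)[OF _ _ M]) (auto intro!: continuous_intros simp: norm_mult)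
  show main: "((\<lambda>m. \<phi> m * fourier_coeff E (n - m)) has_sum fourier_coeff (\<lambda>x. E x * g x) n) UNIV"
    if E: "continuous_on {-pi..pi} E" for E n
  proof -
    obtain G where G: "\<And>x. x \<in> {-pi..pi} \<Longrightarrow> norm (E x) \<le> G"
      using continuous_on_bounded_Icc[OF E] by blast
    define f where "f = (\<lambda>m x. \<phi> m * cis (- (of_int m * x)) * (cis (of_int n * x) * E x))"
    have M': "(\<lambda>m. norm (\<phi> m) * G) summable_on UNIV" by (intro summable_on_cmult_left M)
    have hs: "((\<lambda>m. integral {-pi..pi} (f m)) has_sum integral {-pi..pi} (\<lambda>x. \<Sum>\<^sub>\<infinity>m. f m x)) UNIV"
      by (rule integral_infsum(1)[OF _ _ M'])
         (auto simp: f_def norm_mult intro!: continuous_intros E mult_left_mono G)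
    have 1: "integral {-pi..pi} (f m) * inverse (of_real (2*pi)) = \<phi> m * fourier_coeff E (n - m)" for m
    proof -
      have "cis (- (of_int m * x)) * cis (of_int n * x) = cis (of_int (n - m) * x)" for x
        by (simp add: cis_mult algebra_simps)
      from this[symmetric] have "f m = (\<lambda>x. \<phi> m * (cis (of_int (n - m) * x) * E x))"
        by (simp only: f_def mult.assoc)
      then have "integral {-pi..pi} (f m) = \<phi> m * integral {-pi..pi} (\<lambda>x. cis (of_int (n - m) * x) * E x)"
        by (simp only: integral_mult_right)
      then show ?thesis by (simp only: fourier_coeff_def divide_inverse mult.assoc)
    qed
    have 2: "(\<lambda>x. \<Sum>\<^sub>\<infinity>m. f m x) = (\<lambda>x. cis (of_int n * x) * (E x * g x))"
      unfolding f_def g_def infsum_cmult_left' by (simp add: algebra_simps)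
    show ?thesis
      using has_sum_cmult_left[OF hs, of "inverse (of_real (2*pi))"]
      unfolding 1 2 by (simp only: fourier_coeff_def[of "\<lambda>x. E x * g x"] divide_inverse)
  qed
  show "fourier_coeff g = \<phi>"
  proof
    fix n
    have c: "fourier_coeff (\<lambda>x. 1) k = (if k = 0 then 1 else 0)" for k
      using fourier_coeff_cis[of 0 k] by simp
    have "((\<lambda>m. \<phi> m * fourier_coeff (\<lambda>x. 1) (n - m)) has_sum fourier_coeff g n) UNIV"
      using main[of "\<lambda>x. 1" n] by simp
    moreover have "((\<lambda>m. \<phi> m * fourier_coeff (\<lambda>x. 1) (n - m)) has_sum \<phi> n) UNIV"
      by (rule has_sum_finite_neutralI[of "{n}"]) (auto simp: c)
    ultimately show "fourier_coeff g n = \<phi> n" using has_sum_unique by blast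
  qed
qed

text \<open>The tail of the exponential series at \<open>z\<close> is dominated termwise by the tail
  at \<open>R\<close>. The bound depends on \<open>z\<close> only through \<open>R\<close>, hence is
  uniform over a bounded symbol.\<close>

lemma exp_partial_sum_bound:
  fixes z :: complex
  assumes "norm z \<le> R"
  shows "norm ((\<Sum>k<N. z ^ k / fact k) - exp z) \<le> exp R - (\<Sum>k<N. R ^ k / fact k)"
proof -
  have s: "summable (\<lambda>k. norm z ^ k / fact k)" "summable (\<lambda>k. R ^ k / fact k)"
    using summable_exp[of "norm z"] summable_exp[of R] by (simp_all add: field_simps)
  have z: "(\<lambda>k. z ^ k / fact k) sums exp z" "(\<lambda>k. R ^ k / fact k) sums exp R"
    using exp_converges[of z] exp_converges[of R] by (simp_all add: scaleR_conv_of_real field_simps)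
  have "exp z - (\<Sum>k<N. z ^ k / fact k) = (\<Sum>k. z ^ (k + N) / fact (k + N))"
    using suminf_minus_initial_segment[of "\<lambda>k. z ^ k / fact k" N] z
    by (simp add: sums_iff)
  moreover have "norm \<dots> \<le> (\<Sum>k. R ^ (k + N) / fact (k + N))"
  proof (rule norm_suminf_le)
    show "norm (z ^ (k + N) / fact (k + N)) \<le> R ^ (k + N) / fact (k + N)" for k
      using assms by (simp add: norm_divide norm_power divide_right_mono power_mono)
    show "summable (\<lambda>k. R ^ (k + N) / fact (k + N))" using s(2) by (subst summable_iff_shift)
  qed
  moreover have "(\<Sum>k. R ^ (k + N) / fact (k + N)) = exp R - (\<Sum>k<N. R ^ k / fact k)"
    using suminf_minus_initial_segment[of "\<lambda>k. R ^ k / fact k" N] z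
    by (simp add: sums_iff)
  ultimately show ?thesis by (simp add: norm_minus_commute)
qed

lemma norm_le_l2_norm:
  assumes "u \<in> l2"
  shows "norm (u n) \<le> l2_norm u"
proof -
  have "(\<Sum>m\<in>{n}. (norm (u m))\<^sup>2) \<le> (\<Sum>\<^sub>\<infinity>m. (norm (u m))\<^sup>2)"
    using assms unfolding l2_def by (intro finite_sum_le_infsum) auto
  then show ?thesis unfolding l2_norm_def by (intro real_le_rsqrt) simp
qed

lemma l2_diff:
  assumes "u \<in> l2" "v \<in> l2"
  shows "(\<lambda>n. u n - v n) \<in> l2"
proof -
  have "(norm (u n - v n))\<^sup>2 \<le> 2 * (norm (u n))\<^sup>2 + 2 * (norm (v n))\<^sup>2" for n
  proof -
    have "(norm (u n - v n))\<^sup>2 \<le> (norm (u n) + norm (v n))\<^sup>2"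
      by (intro power_mono norm_triangle_ineq4) auto
    also have "\<dots> \<le> 2 * (norm (u n))\<^sup>2 + 2 * (norm (v n))\<^sup>2"
      using sum_squares_bound[of "norm (u n)" "norm (v n)"] by (simp add: power2_sum)
    finally show ?thesis .
  qed
  moreover have "(\<lambda>n. 2 * (norm (u n))\<^sup>2 + 2 * (norm (v n))\<^sup>2) summable_on UNIV"
    using assms unfolding l2_def by (intro summable_on_add summable_on_cmult_right) auto
  ultimately show ?thesis unfolding l2_def
    by (auto intro: summable_on_comparison_test)
qed

text \<open>Powers of \<open>lattice_op\<close> act as powers of the symbol, so each partial sum of
  the flow consists of the coefficients of a partial sum of the exponential multiplier. These
  multipliers converge uniformly, and Bessel's inequality gives the limit in
  \<open>l2\<close>.\<close>

lemma linear_flow_fourier: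
  assumes J: "(\<lambda>j. \<bar>J j\<bar>) summable_on UNIV" and \<phi>: "\<phi> \<in> l1"
  shows "linear_flow J t \<phi> =
    fourier_coeff (\<lambda>x. exp (- (\<i> * of_real t) * symbol J x) * (\<Sum>\<^sub>\<infinity>m. \<phi> m * cis (- (of_int m * x))))"
proof -
  define g where "g = (\<lambda>x. \<Sum>\<^sub>\<infinity>m. \<phi> m * cis (- (of_int m * x)))"
  have g: "continuous_on {-pi..pi} g" and gphi: "fourier_coeff g = \<phi>"
    using fourier_inversion_l1[OF \<phi>] by (auto simp: g_def)
  note s = continuous_on_symbol[OF J]
  define p where "p = (\<lambda>N x. (\<Sum>k<N. (- (\<i> * of_real t) * symbol J x) ^ k / fact k) * g x)"
  define e where "e = (\<lambda>x. exp (- (\<i> * of_real t) * symbol J x) * g x)"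
  have cp: "continuous_on {-pi..pi} (p N)" for N unfolding p_def by (intro continuous_intros s g) auto
  have ce: "continuous_on {-pi..pi} e" unfolding e_def by (intro continuous_intros s g)
  have partial: "flow_partial_sum J t N \<phi> = fourier_coeff (p N)" for N
  proof
    fix n
    have "p N = (\<lambda>x. \<Sum>k<N. (- (\<i> * of_real t)) ^ k / fact k * (symbol J x ^ k * g x))"
      unfolding p_def sum_distrib_right by (intro ext sum.cong) (simp_all only: power_mult_distrib times_divide_eq_left mult.assoc)
    then have "fourier_coeff (p N) n = (\<Sum>k<N. (- (\<i> * of_real t)) ^ k / fact k * fourier_coeff (\<lambda>x. symbol J x ^ k * g x) n)"
      by (simp only: fourier_coeff_cmult fourier_coeff_sum[OF finite_lessThan] continuous_intros s g)
    then show "flow_partial_sum J t N \<phi> n = fourier_coeff (p N) n"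
      unfolding flow_partial_sum_def gphi[symmetric] lattice_op_funpow_fourier_coeff[OF J g] by simp
  qed
  obtain S where S: "\<And>x. x \<in> {-pi..pi} \<Longrightarrow> norm (symbol J x) \<le> S" using continuous_on_bounded_Icc[OF s] by blast
  obtain G where G: "\<And>x. x \<in> {-pi..pi} \<Longrightarrow> norm (g x) \<le> G" "G > 0" using continuous_on_bounded_Icc[OF g] by blast
  define R where "R = \<bar>t\<bar> * S"
  define \<epsilon> where "\<epsilon> = (\<lambda>N. (exp R - (\<Sum>k<N. R ^ k / fact k)) * G)"
  have "(\<lambda>k. R ^ k / fact k) sums exp R"
    using exp_converges[of R] by (simp add: field_simps)
  then have "\<epsilon> \<longlonglongrightarrow> (exp R - exp R) * G"
    unfolding \<epsilon>_def sums_def by (intro tendsto_intros)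
  then have eps: "\<epsilon> \<longlonglongrightarrow> 0" by simp
  have bound: "norm (p N x - e x) \<le> \<epsilon> N" if x: "x \<in> {-pi..pi}" for N x
  proof -
    have "norm (- (\<i> * of_real t) * symbol J x) \<le> R"
      using S[OF x] by (simp add: norm_mult R_def mult_left_mono)
    from exp_partial_sum_bound[OF this, of N] G(1)[OF x] G(2)
    show ?thesis unfolding p_def e_def \<epsilon>_def left_diff_distrib[symmetric] norm_mult
      by (intro mult_mono order_trans[OF norm_ge_zero]) auto
  qed
  have dif: "(\<lambda>n. fourier_coeff (p N) n - fourier_coeff e n) = fourier_coeff (\<lambda>x. p N x - e x)" for N
    by (intro ext fourier_coeff_diff[symmetric] cp ce)
  have lim: "(\<lambda>N. l2_norm (\<lambda>n. fourier_coeff (p N) n - fourier_coeff e n)) \<longlonglongrightarrow> 0"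
  proof (rule tendsto_sandwich[OF _ _ tendsto_const eps])
    show "eventually (\<lambda>N. l2_norm (\<lambda>n. fourier_coeff (p N) n - fourier_coeff e n) \<le> \<epsilon> N) sequentially"
      unfolding dif using bound by (intro always_eventually allI bessel_inequality(2) continuous_intros cp ce) auto
    show "eventually (\<lambda>N. 0 \<le> l2_norm (\<lambda>n. fourier_coeff (p N) n - fourier_coeff e n)) sequentially"
      by (simp add: l2_norm_def infsum_nonneg)
  qed
  have l2p: "fourier_coeff (p N) \<in> l2" for N
    by (rule continuous_on_bounded_Icc[OF cp[of N]]) (rule bessel_inequality(1)[OF cp])
  have l2e: "fourier_coeff e \<in> l2"
    by (rule continuous_on_bounded_Icc[OF ce]) (rule bessel_inequality(1)[OF ce])
  \<comment> \<open>The \<open>l2\<close> norm dominates every entry, so any \<open>l2\<close> limit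
    is also the entrywise limit. This yields the uniqueness demanded by the definite description in
    \<open>linear_flow\<close>.\<close>
  have pointwise: "(\<lambda>N. fourier_coeff (p N) n) \<longlonglongrightarrow> u n"
    if u: "u \<in> l2" "(\<lambda>N. l2_norm (\<lambda>n. fourier_coeff (p N) n - u n)) \<longlonglongrightarrow> 0" for u n
  proof -
    have "eventually (\<lambda>N. norm (fourier_coeff (p N) n - u n) \<le> l2_norm (\<lambda>n. fourier_coeff (p N) n - u n)) sequentially"
      using norm_le_l2_norm[OF l2_diff[OF l2p u(1)], of _ n] by simp
    from Lim_null_comparison[OF this u(2)] show ?thesis by (simp add: LIM_zero_iff)
  qed
  have "linear_flow J t \<phi> = fourier_coeff e"
    unfolding linear_flow_def partial
  proof (rule the_equality)
    show "fourier_coeff e \<in> l2 \<and> (\<lambda>N. l2_norm (\<lambda>n. fourier_coeff (p N) n - fourier_coeff e n)) \<longlonglongrightarrow> 0"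
      using l2e lim by simp
    show "u = fourier_coeff e" if "u \<in> l2 \<and> (\<lambda>N. l2_norm (\<lambda>n. fourier_coeff (p N) n - u n)) \<longlonglongrightarrow> 0" for u
      using LIMSEQ_unique[OF pointwise[of u] pointwise[OF l2e lim]] that by blast
  qed
  then show ?thesis by (simp only: e_def g_def)
qed

text \<open>The flow is the convolution of \<open>\<phi>\<close> with the coefficients of the
  exponential multiplier, so a supremum bound on that kernel is a bound from \<open>l1\<close> to
  \<open>linf\<close>.\<close>

lemma linear_flow_kernel_bound:
  assumes J: "(\<lambda>j. \<bar>J j\<bar>) summable_on UNIV" and \<phi>: "\<phi> \<in> l1"
    and B: "\<And>n. norm (fourier_coeff (\<lambda>x. exp (- (\<i> * of_real t) * symbol J x)) n) \<le> B"
  shows "linear_flow J t \<phi> \<in> linf \<and> linf_norm (linear_flow J t \<phi>) \<le> B * l1_norm \<phi>"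
proof -
  have M: "(\<lambda>m. norm (\<phi> m)) summable_on UNIV" using \<phi> by (simp add: l1_def)
  have bd: "norm (linear_flow J t \<phi> n) \<le> B * l1_norm \<phi>" for n
  proof -
    define E where "E = (\<lambda>x. exp (- (\<i> * of_real t) * symbol J x))"
    have cE: "continuous_on {-pi..pi} E" unfolding E_def by (intro continuous_intros continuous_on_symbol[OF J])
    have hs: "((\<lambda>m. \<phi> m * fourier_coeff E (n - m)) has_sum linear_flow J t \<phi> n) UNIV"
      using fourier_inversion_l1(3)[OF \<phi> cE] linear_flow_fourier[OF J \<phi>, of t] by (simp add: E_def)
    have "((\<lambda>m. norm (\<phi> m) * B) has_sum (l1_norm \<phi> * B)) UNIV"
      unfolding l1_norm_def using M by (intro has_sum_cmult_left) simp
    then have "norm (linear_flow J t \<phi> n) \<le> l1_norm \<phi> * B"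
      by (rule norm_infsum_le[OF hs]) (use B in \<open>auto simp: norm_mult E_def intro!: mult_left_mono\<close>)
    then show ?thesis by (simp add: mult.commute)
  qed
  then have "linear_flow J t \<phi> \<in> linf" unfolding linf_def by (auto intro!: boundedI)
  moreover have "linf_norm (linear_flow J t \<phi>) \<le> B * l1_norm \<phi>"
    unfolding linf_norm_def using bd by (intro cSUP_least) auto
  ultimately show ?thesis by simp
qed

section \<open>Concave dispersion\<close>

text \<open>Dominated convergence with majorant 1: pointwise convergence of the phases is enough to
  transfer a bound that is uniform in the approximation.\<close>

lemma norm_integral_cis_limit:
  fixes P :: "nat \<Rightarrow> real \<Rightarrow> real"
  assumes cont: "\<And>j. continuous_on {a..b} (P j)"
    and lim: "\<And>x. x \<in> {a..b} \<Longrightarrow> (\<lambda>j. P j x) \<longlonglongrightarrow> Q x"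
    and bd: "eventually (\<lambda>j. norm (integral {a..b} (\<lambda>x. cis (P j x))) \<le> B) sequentially"
  shows "norm (integral {a..b} (\<lambda>x. cis (Q x))) \<le> B"
proof -
  have "(\<lambda>j. integral {a..b} (\<lambda>x. cis (P j x))) \<longlonglongrightarrow> integral {a..b} (\<lambda>x. cis (Q x))"
    by (rule dominated_convergence(2)[where h="\<lambda>_. 1"])
       (auto intro!: integrable_continuous_real continuous_intros cont tendsto_intros lim simp: cis_conv_exp)
  from Lim_norm_ubound[OF _ this bd] show ?thesis by simp
qed

text \<open>Since \<open>1 - cos y = 2 (sin (y / 2))\<^sup>2\<close>, this is 4 times the series of
  \<open>(sin (k x / 2))\<^sup>2 / k powr (1 + \<alpha>)\<close> over \<open>k \<ge> 1\<close>. The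
  summation index is shifted by \<open>Suc\<close>.\<close>

definition dispersion :: "real \<Rightarrow> real \<Rightarrow> real" where
  "dispersion \<alpha> x = (\<Sum>k. 2 * real (Suc k) powr - (1 + \<alpha>) * (1 - cos (real (Suc k) * x)))"

lemma summable_Suc_powr:
  assumes "s < -1"
  shows "summable (\<lambda>k. real (Suc k) powr s)"
  using assms summable_Suc_iff[of "\<lambda>k. real k powr s"] summable_real_powr_iff[of s] by simp

lemma norm_dispersion_term_le:
  "norm (2 * real (Suc k) powr s * (1 - cos y)) \<le> 4 * real (Suc k) powr s"
proof -
  have "2 * real (Suc k) powr s * \<bar>1 - cos y\<bar> \<le> 2 * real (Suc k) powr s * 2"
    using cos_ge_minus_one[of y] cos_le_one[of y] by (intro mult_left_mono) auto
  then show ?thesis by (simp add: abs_mult del: of_nat_Suc)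
qed

lemma continuous_on_dispersion:
  assumes "\<alpha> > 0"
  shows "continuous_on S (dispersion \<alpha>)"
proof -
  have "uniform_limit S (\<lambda>n x. \<Sum>k<n. 2 * real (Suc k) powr - (1 + \<alpha>) * (1 - cos (real (Suc k) * x)))
     (\<lambda>x. \<Sum>k. 2 * real (Suc k) powr - (1 + \<alpha>) * (1 - cos (real (Suc k) * x))) sequentially"
    by (rule Weierstrass_m_test[OF norm_dispersion_term_le])
       (use assms in \<open>auto intro!: summable_mult summable_Suc_powr simp del: of_nat_Suc\<close>)
  then have "continuous_on S (\<lambda>x. \<Sum>k. 2 * real (Suc k) powr - (1 + \<alpha>) * (1 - cos (real (Suc k) * x)))"
    by (rule uniform_limit_theorem[rotated])
       (auto intro!: always_eventually continuous_intros simp del: of_nat_Suc)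
  then show ?thesis by (simp add: dispersion_def[abs_def])
qed

text \<open>A short piece next to \<open>a\<close> contributes at most its length. The lemma serves
  curvature bounds that are available only away from the left end point.\<close>

lemma norm_integral_cis_le_right_limit:
  fixes q :: "real \<Rightarrow> real"
  assumes cont: "continuous_on {a..b} q" and ab: "a < b"
    and bd: "\<And>\<delta>. a < \<delta> \<Longrightarrow> \<delta> < b \<Longrightarrow> norm (integral {\<delta>..b} (\<lambda>x. cis (q x))) \<le> B"
  shows "norm (integral {a..b} (\<lambda>x. cis (q x))) \<le> B"
proof (rule field_le_epsilon)
  fix e :: real assume e: "e > 0"
  define \<delta> where "\<delta> = min (a + e) ((a + b) / 2)"
  have \<delta>: "a < \<delta>" "\<delta> < b" "\<delta> \<le> a + e" using e ab by (auto simp: \<delta>_def min_def)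
  have "integral {a..b} (\<lambda>x. cis (q x)) = integral {a..\<delta>} (\<lambda>x. cis (q x)) + integral {\<delta>..b} (\<lambda>x. cis (q x))"
    using \<delta> by (intro Henstock_Kurzweil_Integration.integral_combine[symmetric] integrable_continuous_real continuous_intros cont) auto
  moreover have "norm (integral {a..\<delta>} (\<lambda>x. cis (q x))) \<le> e"
    using norm_integral_cis_le[of a \<delta> q] continuous_on_subset[OF cont, of "{a..\<delta>}"] \<delta> by force
  ultimately show "norm (integral {a..b} (\<lambda>x. cis (q x))) \<le> B + e"
    using bd[OF \<delta>(1,2)] by (smt (verit) norm_triangle_ineq)
qed

text \<open>Two summations by parts put the second difference on \<open>a\<close>. Writing
  \<open>1 - cos\<close> in place of \<open>cos\<close> makes the trigonometric factors nonnegative,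
  so that the signs of the second differences decide. The induction rests on the three-term
  recurrence of \<open>cos (k x)\<close>.\<close>

lemma sum_cos_by_parts:
  fixes a :: "nat \<Rightarrow> real"
  assumes "a 0 = 0"
  shows "(2 - 2 * cos x) * (\<Sum>k=1..M. a k * cos (real k * x)) =
    - (\<Sum>k=1..M. (2 * a k - a (k - 1) - a (k + 1)) * (1 - cos (real k * x)))
    + a M * (1 - cos (real (M + 1) * x)) - a (M + 1) * (1 - cos (real M * x))"
proof (induction M)
  case 0
  then show ?case using assms by simp
next
  case (Suc M)
  have e: "cos (real (M + 2) * x) + cos (real M * x) = 2 * cos x * cos (real (M + 1) * x)"
  proof -
    have "real (M + 2) * x = real (M + 1) * x + x" "real M * x = real (M + 1) * x - x"
      by (simp_all add: algebra_simps)
    then show ?thesis by (simp add: cos_add cos_diff)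
  qed
  have "(2 - 2 * cos x) * (\<Sum>k=1..Suc M. a k * cos (real k * x)) =
    (2 - 2 * cos x) * (\<Sum>k=1..M. a k * cos (real k * x)) + (2 - 2 * cos x) * (a (M + 1) * cos (real (M + 1) * x))"
    by (simp add: distrib_left)
  moreover have "(\<Sum>k=1..Suc M. (2 * a k - a (k - 1) - a (k + 1)) * (1 - cos (real k * x))) =
    (\<Sum>k=1..M. (2 * a k - a (k - 1) - a (k + 1)) * (1 - cos (real k * x)))
    + (2 * a (M + 1) - a M - a (M + 2)) * (1 - cos (real (M + 1) * x))"
    by simp
  moreover have "(2 - 2 * cos x) * (a (M + 1) * cos (real (M + 1) * x)) =
     - ((2 * a (M + 1) - a M - a (M + 2)) * (1 - cos (real (M + 1) * x)))
     + a (M + 1) * (1 - cos (real (M + 2) * x)) - a (M + 2) * (1 - cos (real (M + 1) * x))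
     - a M * (1 - cos (real (M + 1) * x)) + a (M + 1) * (1 - cos (real M * x))"
    using e by algebra
  ultimately show ?case using Suc.IH by simp
qed

text \<open>
  Both summands of \<open>k powr \<beta> - k powr (\<beta> + 1) / M\<close> are concave in \<open>k\<close>. So the only negative value of
  \<open>2 a k - a (k - 1) - a (k + 1)\<close> is that at the cut-off \<open>k = M\<close>, and it is of order
  \<open>M powr (\<beta> - 1)\<close>, which tends to 0.
\<close>

definition cesaro_coeff :: "real \<Rightarrow> nat \<Rightarrow> nat \<Rightarrow> real" where
  "cesaro_coeff \<beta> M k = (if k \<le> M then real k powr \<beta> - real k powr (\<beta> + 1) / real M else 0)"

context
  fixes \<beta> :: real
  assumes \<beta>: "0 \<le> \<beta>" "\<beta> < 1"
begin

lemma cesaro_coeff_alt: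
  assumes "M > 0" "k \<le> M"
  shows "cesaro_coeff \<beta> M k = real k powr \<beta> * (1 - real k / real M)"
  using assms by (cases "k = 0") (auto simp: cesaro_coeff_def powr_add field_simps)

lemma cesaro_coeff_bounds:
  assumes "M > 0"
  shows "0 \<le> cesaro_coeff \<beta> M k" "cesaro_coeff \<beta> M k \<le> real k powr \<beta>"
proof -
  have "real k powr \<beta> * (1 - real k / real M) \<le> real k powr \<beta> * 1"
    by (intro mult_left_mono) auto
  then show "0 \<le> cesaro_coeff \<beta> M k" "cesaro_coeff \<beta> M k \<le> real k powr \<beta>"
    using assms cesaro_coeff_alt[of M k] by (cases "k \<le> M"; auto simp: cesaro_coeff_def)+
qed

text \<open>Concavity is used at the midpoint of \<open>k - 1\<close> and \<open>k + 1\<close>. It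
  is established on the open half-line, so \<open>k - 1\<close> has to be positive, and
  \<open>k < M\<close> keeps \<open>k + 1\<close> within the cut-off.\<close>

lemma cesaro_coeff_concave:
  assumes "2 \<le> k" "k < M"
  shows "0 \<le> 2 * cesaro_coeff \<beta> M k - cesaro_coeff \<beta> M (k - 1) - cesaro_coeff \<beta> M (k + 1)"
proof -
  define f where "f = (\<lambda>x. x powr \<beta> - x powr (\<beta> + 1) / real M)"
  have "concave_on {0<..} f"
  proof (rule f''_le0_imp_concave)
    fix x :: real assume x: "x \<in> {0<..}"
    show "(f has_real_derivative (\<beta> * x powr (\<beta> - 1) - (\<beta> + 1) * x powr \<beta> / real M)) (at x)"
      unfolding f_def using x assms by (auto intro!: derivative_eq_intros simp: field_simps)
    show "((\<lambda>x. \<beta> * x powr (\<beta> - 1) - (\<beta> + 1) * x powr \<beta> / real M) has_real_derivative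
        (\<beta> * (\<beta> - 1) * x powr (\<beta> - 2) - (\<beta> + 1) * \<beta> * x powr (\<beta> - 1) / real M)) (at x)"
      using x assms by (auto intro!: derivative_eq_intros simp: field_simps)
    have "\<beta> * (\<beta> - 1) * x powr (\<beta> - 2) \<le> 0"
      using \<beta> by (intro mult_nonpos_nonneg mult_nonneg_nonpos) auto
    moreover have "(\<beta> + 1) * \<beta> * x powr (\<beta> - 1) / real M \<ge> 0" using \<beta> by simp
    ultimately show "\<beta> * (\<beta> - 1) * x powr (\<beta> - 2) - (\<beta> + 1) * \<beta> * x powr (\<beta> - 1) / real M \<le> 0"
      by linarith
  qed auto
  from concave_onD[OF this, of "1/2" "real k - 1" "real k + 1"]
  have "f ((1 - 1/2) *\<^sub>R (real k - 1) + (1/2) *\<^sub>R (real k + 1)) \<ge> (1 - 1/2) * f (real k - 1) + (1/2) * f (real k + 1)"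
    using assms by simp
  moreover have "(1 - 1/2) *\<^sub>R (real k - 1) + (1/2) *\<^sub>R (real k + 1) = real k" by (simp add: field_simps)
  ultimately have "2 * f (real k) \<ge> f (real k - 1) + f (real k + 1)" by simp
  moreover have "cesaro_coeff \<beta> M k = f (real k)" "cesaro_coeff \<beta> M (k - 1) = f (real k - 1)"
    "cesaro_coeff \<beta> M (k + 1) = f (real k + 1)"
    using assms by (auto simp: cesaro_coeff_def f_def of_nat_diff add.commute)
  ultimately show ?thesis by linarith
qed

text \<open>Because \<open>a M = a (M + 1) = 0\<close>, the boundary terms of
  \<open>sum_cos_by_parts\<close> vanish. The terms with \<open>2 \<le> k < M\<close> have a
  favourable sign, \<open>k = 1\<close> supplies the main term, and \<open>k = M\<close>, where
  \<open>d M = - a (M - 1)\<close>, supplies the error. Dividing by \<open>2 (1 - cos x)\<close>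
  finishes.\<close>

lemma cesaro_cos_sum_bound:
  assumes M: "M \<ge> 2" and x: "cos x < 1"
  shows "(\<Sum>k=1..M. cesaro_coeff \<beta> M k * cos (real k * x))
    \<le> - (1 - 1 / real M - 2 powr \<beta> / 2) + real M powr (\<beta> - 1) / (1 - cos x)"
proof -
  define a where "a = cesaro_coeff \<beta> M"
  define d where "d = (\<lambda>k. 2 * a k - a (k - 1) - a (k + 1))"
  have a0: "a 0 = 0" and aM: "a M = 0" "a (M + 1) = 0"
    using M cesaro_coeff_alt[of M M] by (auto simp: a_def cesaro_coeff_def)
  \<comment> \<open>Here \<open>a 1 = 1 - 1 / M\<close> and
    \<open>a 2 \<le> 2 powr \<beta>\<close>.\<close>
  have d1: "d 1 \<ge> 2 - 2 / real M - 2 powr \<beta>"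
    using M cesaro_coeff_bounds(2)[of M 2] a0 by (auto simp: d_def a_def cesaro_coeff_def)
  have aM1: "a (M - 1) \<le> real M powr (\<beta> - 1)"
  proof -
    have "a (M - 1) = real (M - 1) powr \<beta> * (1 / real M)"
      using M cesaro_coeff_alt[of M "M - 1"] by (simp add: a_def of_nat_diff field_simps)
    also have "\<dots> \<le> real M powr \<beta> * (1 / real M)"
      using M \<beta> by (intro mult_right_mono powr_mono2) auto
    also have "\<dots> = real M powr (\<beta> - 1)" using M by (simp add: powr_diff)
    finally show ?thesis .
  qed
  have c: "1 - cos (real k * x) \<ge> 0" "1 - cos (real k * x) \<le> 2" for k
    using cos_ge_minus_one[of "real k * x"] by auto
  have "(\<Sum>k=1..M. d k * (1 - cos (real k * x))) =
     d 1 * (1 - cos x) + (\<Sum>k=2..<M. d k * (1 - cos (real k * x))) + d M * (1 - cos (real M * x))"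
  proof -
    have "{1..M} = insert 1 (insert M {2..<M})" using M by auto
    then show ?thesis using M by simp
  qed
  moreover have "(\<Sum>k=2..<M. d k * (1 - cos (real k * x))) \<ge> 0"
    using c cesaro_coeff_concave by (intro sum_nonneg mult_nonneg_nonneg) (auto simp: d_def a_def)
  moreover have "d M * (1 - cos (real M * x)) \<ge> - (real M powr (\<beta> - 1)) * 2"
  proof -
    have "a (M - 1) * (1 - cos (real M * x)) \<le> real M powr (\<beta> - 1) * 2"
      using aM1 c[of M] by (intro mult_mono) auto
    then show ?thesis unfolding d_def aM by simp
  qed
  moreover have "d 1 * (1 - cos x) \<ge> (2 - 2 / real M - 2 powr \<beta>) * (1 - cos x)"
    using d1 x by (intro mult_right_mono) auto
  ultimately have *: "(2 - 2 * cos x) * (\<Sum>k=1..M. a k * cos (real k * x))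
      \<le> - ((2 - 2 / real M - 2 powr \<beta>) * (1 - cos x)) + real M powr (\<beta> - 1) * 2"
    using sum_cos_by_parts[of a x M, OF a0] unfolding aM d_def by linarith
  have "(1 - cos x) * (\<Sum>k=1..M. a k * cos (real k * x))
      \<le> (1 - cos x) * (- (1 - 1 / real M - 2 powr \<beta> / 2) + real M powr (\<beta> - 1) / (1 - cos x))"
  proof -
    define S where "S = (\<Sum>k=1..M. a k * cos (real k * x))"
    have "(1 - cos x) * (- A + B / (1 - cos x)) = - ((1 - cos x) * A) + B" for A B
      using x by (simp add: right_diff_distrib)
    note this[of "1 - 1 / real M - 2 powr \<beta> / 2" "real M powr (\<beta> - 1)"]
    moreover have "(2 - 2 * cos x) * S = 2 * ((1 - cos x) * S)" by (simp add: algebra_simps)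
    moreover have "(2 - 2 / real M - 2 powr \<beta>) * (1 - cos x) = 2 * ((1 - cos x) * (1 - 1 / real M - 2 powr \<beta> / 2))"
      by (simp add: field_simps)
    ultimately show ?thesis using * unfolding S_def[symmetric] by linarith
  qed
  then show ?thesis using x by (simp add: a_def)
qed

lemma cesaro_cos_sum_bound_eventually:
  assumes \<delta>: "0 < \<delta>" "\<delta> < pi"
  shows "eventually (\<lambda>M. \<forall>x\<in>{\<delta>..pi}. (\<Sum>k=1..M. 2 * (cesaro_coeff \<beta> M k * cos (real k * x)))
      \<le> - ((2 - 2 powr \<beta>) / 2)) sequentially"
proof -
  have b: "2 powr \<beta> < 2 powr (1::real)" using \<beta> by (intro powr_less_mono) auto
  have cd: "cos \<delta> < 1" using \<delta> cos_monotone_0_pi[of 0 \<delta>] by simp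
  have "(\<lambda>M. - (1 - 1 / real M - 2 powr \<beta> / 2) + real M powr (\<beta> - 1) / (1 - cos \<delta>))
      \<longlonglongrightarrow> - (1 - 0 - 2 powr \<beta> / 2) + 0 / (1 - cos \<delta>)"
    using \<beta> cd
    by (intro tendsto_intros lim_1_over_n tendsto_neg_powr filterlim_real_sequentially) auto
  \<comment> \<open>The limit is \<open>- (2 - 2 powr \<beta>) / 2\<close>; half of it is kept as a
    strict upper bound, and the factor 2 in the statement restores the constant. The error is
    uniform in \<open>x\<close> because \<open>1 - cos x \<ge> 1 - cos \<delta>\<close>.\<close>
  then have "eventually (\<lambda>M. - (1 - 1 / real M - 2 powr \<beta> / 2) + real M powr (\<beta> - 1) / (1 - cos \<delta>)
      < - ((2 - 2 powr \<beta>) / 4)) sequentially"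
    using b by (intro order_tendstoD(2)) (auto simp: field_simps)
  then show ?thesis using eventually_ge_at_top[of 2]
  proof eventually_elim
    case (elim M)
    show ?case
    proof
      fix x assume x: "x \<in> {\<delta>..pi}"
      have cx: "cos x \<le> cos \<delta>" using x \<delta> by (intro cos_monotone_0_pi_le) auto
      have "real M powr (\<beta> - 1) / (1 - cos x) \<le> real M powr (\<beta> - 1) / (1 - cos \<delta>)"
        using cx cd by (intro divide_left_mono) auto
      with cesaro_cos_sum_bound[of M x] elim cx cd
      have "(\<Sum>k=1..M. cesaro_coeff \<beta> M k * cos (real k * x)) \<le> - ((2 - 2 powr \<beta>) / 4)" by linarith
      then show "(\<Sum>k=1..M. 2 * (cesaro_coeff \<beta> M k * cos (real k * x))) \<le> - ((2 - 2 powr \<beta>) / 2)"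
        unfolding sum_distrib_left[symmetric] by linarith
    qed
  qed
qed

text \<open>Extended by zero beyond the cut-off, the finite sums are series to which Tannery's
  theorem applies with the majorant \<open>4 k powr (\<beta> - 2)\<close>, summable since
  \<open>\<beta> < 1\<close>. Division by the square of \<open>k\<close> undoes the two derivatives
  that produce the cosine sum.\<close>

lemma cesaro_dispersion_limit:
  "(\<lambda>M. \<Sum>k=1..M. 2 * cesaro_coeff \<beta> M k * (1 - cos (real k * x)) / (real k)\<^sup>2) \<longlonglongrightarrow> dispersion (1 - \<beta>) x"
proof -
  define T where "T = (\<lambda>k M. 2 * cesaro_coeff \<beta> M (Suc k) * (1 - cos (real (Suc k) * x)) / (real (Suc k))\<^sup>2)"
  have "(\<Sum>k=1..M. 2 * cesaro_coeff \<beta> M k * (1 - cos (real k * x)) / (real k)\<^sup>2) = (\<Sum>k. T k M)" for M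
  proof -
    have "(\<Sum>k. T k M) = (\<Sum>k<M. T k M)"
      by (rule suminf_finite) (auto simp: T_def cesaro_coeff_def)
    also have "\<dots> = (\<Sum>k=1..M. 2 * cesaro_coeff \<beta> M k * (1 - cos (real k * x)) / (real k)\<^sup>2)"
      unfolding T_def by (simp add: sum.atLeast1_atMost_eq)
    finally show ?thesis by simp
  qed
  moreover have "(\<lambda>M. \<Sum>k. T k M) \<longlonglongrightarrow> (\<Sum>k. 2 * real (Suc k) powr - (1 + (1 - \<beta>)) * (1 - cos (real (Suc k) * x)))"
  proof (rule tannerys_theorem[THEN conjunct2, THEN conjunct2])
    have pw: "real (Suc k) powr - (1 + (1 - \<beta>)) = real (Suc k) powr \<beta> / (real (Suc k))\<^sup>2" for k
    proof -
      have "real (Suc k) powr - (1 + (1 - \<beta>)) = real (Suc k) powr (\<beta> - 2)" by simp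
      then show ?thesis by (simp only: powr_diff) (simp add: powr_numeral)
    qed
    fix k
    have "(\<lambda>M. cesaro_coeff \<beta> M (Suc k)) \<longlonglongrightarrow> real (Suc k) powr \<beta>"
    proof (rule Lim_transform_eventually)
      have "(\<lambda>M. real (Suc k) powr \<beta> - real (Suc k) powr (\<beta> + 1) * (1 / real M)) \<longlonglongrightarrow> real (Suc k) powr \<beta> - real (Suc k) powr (\<beta> + 1) * 0"
        by (intro tendsto_intros lim_1_over_n)
      then show "(\<lambda>M. real (Suc k) powr \<beta> - real (Suc k) powr (\<beta> + 1) * (1 / real M)) \<longlonglongrightarrow> real (Suc k) powr \<beta>" by simp
      show "eventually (\<lambda>M. real (Suc k) powr \<beta> - real (Suc k) powr (\<beta> + 1) * (1 / real M) = cesaro_coeff \<beta> M (Suc k)) sequentially"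
        using eventually_ge_at_top[of "Suc k"] by eventually_elim (simp add: cesaro_coeff_def)
    qed
    then have "(\<lambda>M. T k M) \<longlonglongrightarrow> 2 * real (Suc k) powr \<beta> * (1 - cos (real (Suc k) * x)) / (real (Suc k))\<^sup>2"
      unfolding T_def by (intro tendsto_intros) auto
    then show "(\<lambda>M. T k M) \<longlonglongrightarrow> 2 * real (Suc k) powr - (1 + (1 - \<beta>)) * (1 - cos (real (Suc k) * x))"
      unfolding pw by simp
  next
    have "norm (T k M) \<le> 4 * real (Suc k) powr (\<beta> - 2)" if "M > 0" for k M
    proof -
      have "norm (T k M) = cesaro_coeff \<beta> M (Suc k) * (2 * \<bar>1 - cos (real (Suc k) * x)\<bar>) / (real (Suc k))\<^sup>2"
        using cesaro_coeff_bounds[OF that, of "Suc k"] by (simp add: T_def abs_mult)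
      also have "\<dots> \<le> real (Suc k) powr \<beta> * (2 * 2) / (real (Suc k))\<^sup>2"
        using cesaro_coeff_bounds[OF that, of "Suc k"] cos_ge_minus_one[of "real (Suc k) * x"]
        by (intro divide_right_mono mult_mono) (auto simp del: of_nat_Suc)
      also have "\<dots> = 4 * real (Suc k) powr (\<beta> - 2)"
        by (simp only: powr_diff) (simp add: powr_numeral)
      finally show ?thesis .
    qed
    then show "\<forall>\<^sub>F (k, M) in at_top \<times>\<^sub>F sequentially. norm (T k M) \<le> 4 * real (Suc k) powr (\<beta> - 2)"
      unfolding eventually_prod_filter using eventually_gt_at_top[of "0::nat"]
      by (intro exI[of _ "\<lambda>_. True"] exI[of _ "\<lambda>M. 0 < M"]) auto
  next
    show "summable (\<lambda>k. 4 * real (Suc k) powr (\<beta> - 2))"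
      using \<beta> by (intro summable_mult summable_Suc_powr) auto
  qed auto
  ultimately show ?thesis unfolding dispersion_def by simp
qed

text \<open>The order of limits matters: for fixed \<open>\<delta>\<close> the curvature bound on
  \<open>[\<delta>, pi]\<close> holds for all large \<open>M\<close>, so first \<open>M\<close>
  tends to infinity and only then \<open>\<delta>\<close> to 0. The van der Corput bound involves
  neither.\<close>

lemma oscillatory_bound_concave:
  assumes t: "t > 0"
  shows "norm (integral {0..pi} (\<lambda>x. cis (c * x - t * dispersion (1 - \<beta>) x)))
           \<le> 18 / sqrt (t * ((2 - 2 powr \<beta>) / 2))"
proof -
  define \<kappa> where "\<kappa> = (2 - 2 powr \<beta>) / 2"
  have \<kappa>: "\<kappa> > 0" using \<beta> powr_less_mono[of \<beta> 1 2] by (simp add: \<kappa>_def)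
  define p where "p = (\<lambda>M x. \<Sum>k=1..M. 2 * cesaro_coeff \<beta> M k * (1 - cos (real k * x)) / (real k)\<^sup>2)"
  define p' where "p' = (\<lambda>M x. \<Sum>k=1..M. 2 * (cesaro_coeff \<beta> M k * sin (real k * x) / real k))"
  define p'' where "p'' = (\<lambda>M x. \<Sum>k=1..M. 2 * (cesaro_coeff \<beta> M k * cos (real k * x)))"
  have dp: "(p M has_real_derivative p' M x) (at x within S)" for M x S
    unfolding p_def p'_def
    by (auto intro!: derivative_eq_intros sum.cong simp: power2_eq_square)
  have dp': "(p' M has_real_derivative p'' M x) (at x within S)" for M x S
    unfolding p'_def p''_def by (auto intro!: derivative_eq_intros sum.cong)
  have part: "norm (integral {\<delta>..pi} (\<lambda>x. cis (c * x - t * dispersion (1 - \<beta>) x))) \<le> 18 / sqrt (t * \<kappa>)"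
    if \<delta>: "0 < \<delta>" "\<delta> < pi" for \<delta>
  proof (rule norm_integral_cis_limit[where P="\<lambda>M x. c * x - t * p M x"])
    show "continuous_on {\<delta>..pi} (\<lambda>x. c * x - t * p M x)" for M
      unfolding p_def by (auto intro!: continuous_intros)
    show "(\<lambda>M. c * x - t * p M x) \<longlonglongrightarrow> c * x - t * dispersion (1 - \<beta>) x" for x
      unfolding p_def by (intro tendsto_intros cesaro_dispersion_limit)
    show "eventually (\<lambda>M. norm (integral {\<delta>..pi} (\<lambda>x. cis (c * x - t * p M x))) \<le> 18 / sqrt (t * \<kappa>)) sequentially"
      using cesaro_cos_sum_bound_eventually[OF \<delta>]
    proof eventually_elim
      case (elim M)
      show ?case
      proof (rule van_der_corput_second)
        show "((\<lambda>x. c * x - t * p M x) has_real_derivative (c - t * p' M x)) (at x within {\<delta>..pi})" for x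
          by (auto intro!: derivative_eq_intros dp)
        show "continuous_on {\<delta>..pi} (\<lambda>x. c - t * p' M x)"
          unfolding p'_def by (auto intro!: continuous_intros)
        show "t * \<kappa> * (y - x) \<le> (c - t * p' M y) - (c - t * p' M x)" if xy: "\<delta> \<le> x" "x \<le> y" "y \<le> pi" for x y
        proof -
          \<comment> \<open>The curvature bound makes \<open>p' M x + \<kappa> x\<close>
            nonincreasing in \<open>x\<close>; this is the increment condition for the phase, whose
            derivative contains \<open>- t * p' M\<close>.\<close>
          have "p' M y + \<kappa> * y \<le> p' M x + \<kappa> * x"
          proof (rule DERIV_nonpos_imp_nonincreasing[OF xy(2)])
            fix z assume z: "x \<le> z" "z \<le> y"
            have "((\<lambda>x. p' M x + \<kappa> * x) has_real_derivative (p'' M z + \<kappa>)) (at z)"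
              by (auto intro!: derivative_eq_intros dp')
            moreover have "p'' M z + \<kappa> \<le> 0" using bspec[OF elim, of z] z xy unfolding p''_def \<kappa>_def by force
            ultimately show "\<exists>y. ((\<lambda>x. p' M x + \<kappa> * x) has_real_derivative y) (at z) \<and> y \<le> 0" by blast
          qed
          then have "t * (\<kappa> * (y - x)) \<le> t * (p' M x - p' M y)" using t by (intro mult_left_mono) (auto simp: algebra_simps)
          then show ?thesis by (simp add: algebra_simps)
        qed
      qed (use \<delta> t \<kappa> in auto)
    qed
  qed
  have "norm (integral {0..pi} (\<lambda>x. cis (c * x - t * dispersion (1 - \<beta>) x))) \<le> 18 / sqrt (t * \<kappa>)"
    by (rule norm_integral_cis_le_right_limit[OF _ pi_gt_zero part])
       (use \<beta> in \<open>auto intro!: continuous_intros continuous_on_dispersion\<close>)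
  then show ?thesis by (simp add: \<kappa>_def)
qed

end

section \<open>A positive sine series\<close>

text \<open>The substitution \<open>t \<mapsto> c t\<close> in the Gamma integral exhibits
  \<open>c powr - s\<close> as a mixture of the exponentials \<open>exp (- (c t))\<close>.\<close>

lemma Gamma_has_bochner_integral:
  fixes s c :: real
  assumes s: "s > 0" and c: "c > 0"
  shows "has_bochner_integral lborel (\<lambda>t. indicator {0..} t * t powr (s - 1) * exp (- (c * t))) (Gamma s * c powr - s)"
proof -
  define h where "h = (\<lambda>t::real. indicator {0..} t * t powr (s - 1) * exp (- t))"
  have "has_bochner_integral lborel h (Gamma s)"
  proof (rule has_bochner_integral_nn_integral)
    show "h \<in> borel_measurable lborel" unfolding h_def by measurable
    show "AE x in lborel. 0 \<le> h x" by (simp add: h_def)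
    show "(\<integral>\<^sup>+x. ennreal (h x) \<partial>lborel) = ennreal (Gamma s)"
      using Gamma_conv_nn_integral_real[OF s] by (simp add: h_def exp_minus divide_inverse)
  qed (use s in \<open>simp add: less_imp_le\<close>)
  then have "has_bochner_integral lborel (\<lambda>x. h (0 + c * x)) (Gamma s /\<^sub>R \<bar>c\<bar>)"
    using c lborel_has_bochner_integral_real_affine_iff[of c h "Gamma s" 0] by simp
  then have "has_bochner_integral lborel (\<lambda>x. c powr (1 - s) * h (0 + c * x)) (c powr (1 - s) * (Gamma s /\<^sub>R \<bar>c\<bar>))"
    by (rule has_bochner_integral_mult_right)
  also have "(\<lambda>x. c powr (1 - s) * h (0 + c * x)) = (\<lambda>t. indicator {0..} t * t powr (s - 1) * exp (- (c * t)))"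
  proof
    fix t :: real
    have "c powr (1 - s) * (c * t) powr (s - 1) = t powr (s - 1)" if "t \<ge> 0"
      using that c powr_add[of c "1 - s" "s - 1"] by (simp add: powr_mult)
    moreover have "indicator {0..} (c * t) = (indicator {0..} t :: real)"
      using c by (simp add: indicator_def zero_le_mult_iff)
    ultimately show "c powr (1 - s) * h (0 + c * t) = indicator {0..} t * t powr (s - 1) * exp (- (c * t))"
      unfolding h_def by (simp add: indicator_def)
  qed
  also have "c powr (1 - s) * (Gamma s /\<^sub>R \<bar>c\<bar>) = Gamma s * c powr - s"
    using c by (simp add: powr_diff powr_minus field_simps)
  finally show ?thesis .
qed

text \<open>The exponential sums are integrated against the positive density
  \<open>t powr (s - 1)\<close>, and the factor \<open>Gamma s > 0\<close> is divided out. Absolute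
  summability of \<open>c\<close> justifies exchanging sum and integral.\<close>

lemma sum_powr_nonneg_of_exp_nonneg:
  fixes c :: "nat \<Rightarrow> real"
  assumes s: "s > 0" and c: "summable (\<lambda>k. \<bar>c k\<bar>)"
    and nonneg: "\<And>t. t \<ge> 0 \<Longrightarrow> (\<Sum>k. c k * exp (- (real (Suc k) * t))) \<ge> 0"
  shows "(\<Sum>k. c k * real (Suc k) powr - s) \<ge> 0"
proof -
  define h where "h = (\<lambda>k t::real. indicator {0..} t * t powr (s - 1) * exp (- (real (Suc k) * t)))"
  have hb: "has_bochner_integral lborel (h k) (Gamma s * real (Suc k) powr - s)" for k
    unfolding h_def by (rule Gamma_has_bochner_integral[OF s]) simp
  have hc: "has_bochner_integral lborel (\<lambda>t. c k * h k t) (c k * (Gamma s * real (Suc k) powr - s))" for k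
    by (rule has_bochner_integral_mult_right[OF hb])
  have nc: "has_bochner_integral lborel (\<lambda>t. norm (c k * h k t)) (\<bar>c k\<bar> * (Gamma s * real (Suc k) powr - s))" for k
    using has_bochner_integral_mult_right[OF hb[of k], of "\<bar>c k\<bar>"] by (simp add: h_def abs_mult)
  have le: "\<bar>c k\<bar> * exp (- (real (Suc k) * t)) \<le> \<bar>c k\<bar>" if "t \<ge> 0" for k t
    using that by (intro mult_left_le) auto
  have "(\<Sum>k. \<integral>t. c k * h k t \<partial>lborel) = (\<integral>t. (\<Sum>k. c k * h k t) \<partial>lborel)"
  proof (rule integral_suminf[symmetric])
    show "integrable lborel (\<lambda>t. c k * h k t)" for k using hc by (rule integrable.intros)
    show "AE t in lborel. summable (\<lambda>k. norm (c k * h k t))"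
    proof (intro always_eventually allI)
      fix t :: real
      show "summable (\<lambda>k. norm (c k * h k t))"
      proof (cases "t \<ge> 0")
        case True
        have "summable (\<lambda>k. \<bar>c k\<bar> * exp (- (real (Suc k) * t)))"
          by (rule summable_comparison_test'[OF c]) (use le[OF True] in \<open>simp add: abs_mult\<close>)
        from summable_mult[OF this, of "t powr (s - 1)"] True show ?thesis
          by (simp add: h_def abs_mult mult_ac)
      qed (simp add: h_def)
    qed
    have "summable (\<lambda>k. \<bar>c k\<bar> * (Gamma s * real (Suc k) powr - s))"
    proof (rule summable_comparison_test'[OF summable_mult2[OF c, of "Gamma s"]])
      fix k
      have "Gamma s * real (Suc k) powr - s \<le> Gamma s * 1"
        using s by (intro mult_left_mono) (auto intro!: powr_le_one_le simp: powr_minus inverse_le_1_iff ge_one_powr_ge_zero less_imp_le simp del: of_nat_Suc)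
      then show "norm (\<bar>c k\<bar> * (Gamma s * real (Suc k) powr - s)) \<le> \<bar>c k\<bar> * Gamma s"
        using s by (simp add: abs_mult mult_left_mono less_imp_le)
    qed
    then show "summable (\<lambda>k. \<integral>t. norm (c k * h k t) \<partial>lborel)"
      unfolding has_bochner_integral_integral_eq[OF nc] .
  qed
  also have "\<dots> \<ge> 0"
  proof (rule integral_nonneg_AE, intro always_eventually allI)
    fix t :: real
    show "0 \<le> (\<Sum>k. c k * h k t)"
    proof (cases "t \<ge> 0")
      case True
      have sm: "summable (\<lambda>k. c k * exp (- (real (Suc k) * t)))"
        by (rule summable_comparison_test'[OF c]) (use le[OF True] in \<open>simp add: abs_mult\<close>)
      have "(\<Sum>k. c k * h k t) = (\<Sum>k. t powr (s - 1) * (c k * exp (- (real (Suc k) * t))))"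
        using True by (simp add: h_def mult_ac)
      also have "\<dots> = t powr (s - 1) * (\<Sum>k. c k * exp (- (real (Suc k) * t)))"
        by (rule suminf_mult[OF sm])
      finally show ?thesis using nonneg[OF True] by simp
    qed (simp add: h_def)
  qed
  also have "(\<Sum>k. \<integral>t. c k * h k t \<partial>lborel) = (\<Sum>k. Gamma s * (c k * real (Suc k) powr - s))"
    unfolding has_bochner_integral_integral_eq[OF hc] by (simp only: mult_ac)
  also have "\<dots> = Gamma s * (\<Sum>k. c k * real (Suc k) powr - s)"
  proof (rule suminf_mult)
    show "summable (\<lambda>k. c k * real (Suc k) powr - s)"
    proof (rule summable_comparison_test'[OF c])
      fix k
      have "real (Suc k) powr - s \<le> 1"
        using s by (auto simp: powr_minus inverse_le_1_iff ge_one_powr_ge_zero less_imp_le simp del: of_nat_Suc)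
      then show "norm (c k * real (Suc k) powr - s) \<le> \<bar>c k\<bar>" by (simp add: abs_mult mult_left_le)
    qed
  qed
  finally show ?thesis using Gamma_real_pos[OF s] by (simp add: zero_le_mult_iff)
qed

text \<open>The series is the imaginary part of \<open>z / (1 - z)\<^sup>2\<close> at
  \<open>z = r * cis x\<close>, and the denominator \<open>D\<close> is the squared modulus of
  \<open>1 - z\<close>. From \<open>norm (1 - z) \<le> 2\<close> follows
  \<open>D\<^sup>2 \<le> 16\<close>, the source of the constant 16.\<close>

lemma sum_geometric_sin_ge:
  fixes r x :: real
  assumes r: "0 < r" "r < 1" and x: "0 \<le> x" "x \<le> pi"
  shows "(\<lambda>k. real (Suc k) * r ^ Suc k * sin (real (Suc k) * x)) sums
      (r * (1 - r\<^sup>2) * sin x / (1 - 2 * r * cos x + r\<^sup>2)\<^sup>2)"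
    and "r * (1 - r\<^sup>2) * sin x / (1 - 2 * r * cos x + r\<^sup>2)\<^sup>2 \<ge> (r - r ^ 3) / 16 * sin x"
proof -
  define z where "z = of_real r * cis x"
  have nz: "norm z < 1" using r by (simp add: z_def norm_mult)
  define D where "D = 1 - 2 * r * cos x + r\<^sup>2"
  have D: "D = (norm (1 - z))\<^sup>2"
  proof -
    have "(norm (1 - z))\<^sup>2 = (1 - r * cos x)\<^sup>2 + (r * sin x)\<^sup>2" by (simp add: cmod_power2 z_def)
    also have "\<dots> = 1 - 2 * r * cos x + r\<^sup>2 * ((sin x)\<^sup>2 + (cos x)\<^sup>2)"
      unfolding distrib_left by (simp add: power2_eq_square algebra_simps)
    finally show ?thesis by (simp add: D_def)
  qed
  have "z \<noteq> 1" using nz by auto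
  then have Dpos: "D > 0" by (simp add: D)
  have "(\<lambda>k. z * (of_nat (Suc k) * z ^ k)) sums (z * (1 / (1 - z)\<^sup>2))"
    by (rule sums_mult[OF geometric_deriv_sums[OF nz]])
  then have "(\<lambda>k. Im (z * (of_nat (Suc k) * z ^ k))) sums Im (z * (1 / (1 - z)\<^sup>2))"
    by (rule sums_Im)
  moreover have "Im (z * (of_nat (Suc k) * z ^ k)) = real (Suc k) * r ^ Suc k * sin (real (Suc k) * x)" for k
  proof -
    have "z * (of_nat (Suc k) * z ^ k) = of_real (real (Suc k)) * z ^ Suc k" by simp
    also have "z ^ Suc k = of_real (r ^ Suc k) * cis (real (Suc k) * x)"
      by (simp only: z_def power_mult_distrib Complex.DeMoivre of_real_power)
    finally have e: "z * (of_nat (Suc k) * z ^ k) = of_real (real (Suc k)) * (of_real (r ^ Suc k) * cis (real (Suc k) * x))" .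
    show ?thesis unfolding e by simp
  qed
  moreover have "Im (z * (1 / (1 - z)\<^sup>2)) = r * (1 - r\<^sup>2) * sin x / D\<^sup>2"
  proof -
    \<comment> \<open>Expanding by the conjugate makes the denominator real, so the imaginary part
      can be read off the numerator.\<close>
    have "z * (1 / (1 - z)\<^sup>2) = z * (cnj (1 - z))\<^sup>2 / ((1 - z) * cnj (1 - z))\<^sup>2"
      using \<open>z \<noteq> 1\<close> by (simp add: power_mult_distrib)
    also have "(1 - z) * cnj (1 - z) = of_real D"
      by (simp only: D complex_norm_square)
    finally have "Im (z * (1 / (1 - z)\<^sup>2)) = Im (z * (cnj (1 - z))\<^sup>2) / D\<^sup>2"
      by (simp only: Im_divide_of_real flip: of_real_power)
    also have "Im (z * (cnj (1 - z))\<^sup>2) = r * sin x * (1 - (r * sin x) * (r * sin x) - (r * cos x) * (r * cos x))"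
      by (simp add: z_def power2_eq_square algebra_simps)
    also have "\<dots> = r * (1 - r\<^sup>2) * sin x"
      using sin_cos_squared_add[of x] by algebra
    finally show ?thesis .
  qed
  ultimately show "(\<lambda>k. real (Suc k) * r ^ Suc k * sin (real (Suc k) * x)) sums
      (r * (1 - r\<^sup>2) * sin x / (1 - 2 * r * cos x + r\<^sup>2)\<^sup>2)"
    by (simp only: D_def)
  have "norm (1 - z) \<le> 2" using norm_triangle_ineq4[of 1 z] nz by simp
  then have "D \<le> 4" unfolding D using power_mono[of "norm (1 - z)" 2 2] by simp
  then have "D\<^sup>2 \<le> 16" using Dpos power_mono[of D 4 2] by simp
  moreover have "0 \<le> r * (1 - r\<^sup>2) * sin x"
    using r x by (intro mult_nonneg_nonneg sin_ge_zero) (auto simp: power_le_one)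
  ultimately have "r * (1 - r\<^sup>2) * sin x / 16 \<le> r * (1 - r\<^sup>2) * sin x / D\<^sup>2"
    using Dpos by (intro divide_left_mono) auto
  then show "r * (1 - r\<^sup>2) * sin x / (1 - 2 * r * cos x + r\<^sup>2)\<^sup>2 \<ge> (r - r ^ 3) / 16 * sin x"
    by (simp add: D_def power2_eq_square power3_eq_cube algebra_simps)
qed

text \<open>
  The lower bound \<open>(r - r ^ 3) / 16 * sin x\<close> for the geometric series is itself a combination of powers
  of \<open>r\<close>, so the difference of both sides can be integrated against the Gamma density term by term.
\<close>

lemma sum_powr_sin_ge:
  fixes \<rho> x s :: real
  assumes \<rho>: "0 < \<rho>" "\<rho> < 1" and x: "0 \<le> x" "x \<le> pi" and s: "s > 0"
  shows "(\<Sum>k. real (Suc k) powr (1 - s) * \<rho> ^ Suc k * sin (real (Suc k) * x))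
           \<ge> (\<rho> - \<rho> ^ 3 * 3 powr - s) / 16 * sin x"
proof -
  define A where "A = (\<lambda>k. real (Suc k) * \<rho> ^ Suc k * sin (real (Suc k) * x))"
  \<comment> \<open>Index \<open>k\<close> stands for the power \<open>Suc k\<close>, so the two
    terms of the lower bound, with powers 1 and 3, sit at the indices 0 and 2.\<close>
  define B where "B = (\<lambda>k. if k = 0 then \<rho> / 16 * sin x else if k = (2::nat) then - (\<rho> ^ 3 / 16 * sin x) else 0)"
  have g: "summable (\<lambda>k. real (Suc k) * \<rho> ^ Suc k)"
    using summable_mult[OF sums_summable[OF geometric_deriv_sums[of \<rho>]], of \<rho>] \<rho> by (simp add: mult_ac)
  have absA: "summable (\<lambda>k. \<bar>A k\<bar>)"
    by (rule summable_comparison_test'[OF g])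
       (use \<rho> in \<open>auto simp: A_def abs_mult intro!: mult_left_le simp del: of_nat_Suc power_Suc\<close>)
  have B: "(\<lambda>k. B k * q k) sums (\<rho> / 16 * sin x * q 0 - \<rho> ^ 3 / 16 * sin x * q 2)" for q
    using sums_finite[of "{0, 2}" "\<lambda>k. B k * q k"] by (simp add: B_def)
  have absB: "summable (\<lambda>k. \<bar>B k\<bar>)"
    by (rule summable_finite[of "{0, 2}"]) (auto simp: B_def)
  have bdd: "summable (\<lambda>k. A k * q k)" if "\<And>k. \<bar>q k\<bar> \<le> 1" for q
    by (rule summable_comparison_test'[OF absA]) (use that in \<open>simp add: abs_mult mult_left_le\<close>)
  have "(\<Sum>k. (A k - B k) * real (Suc k) powr - s) \<ge> 0"
  proof (rule sum_powr_nonneg_of_exp_nonneg[OF s])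
    show "summable (\<lambda>k. \<bar>A k - B k\<bar>)"
      by (rule summable_comparison_test'[OF summable_add[OF absA absB]]) auto
    fix t :: real assume t: "t \<ge> 0"
    \<comment> \<open>The factor \<open>exp (- t)\<close> is absorbed into the radius, so the
      exponential sum is the geometric sine series at \<open>r\<close>.\<close>
    define r where "r = \<rho> * exp (- t)"
    have r: "0 < r" "r < 1"
      using \<rho> t mult_less_le_imp_less[of \<rho> 1 "exp (- t)" 1] by (auto simp: r_def)
    have rk: "r ^ k = \<rho> ^ k * exp (- (real k * t))" for k
      by (simp add: r_def power_mult_distrib flip: exp_of_nat_mult)
    have "(\<lambda>k. A k * exp (- (real (Suc k) * t))) = (\<lambda>k. real (Suc k) * r ^ Suc k * sin (real (Suc k) * x))"
      unfolding A_def rk by (simp only: mult_ac)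
    then have "(\<lambda>k. A k * exp (- (real (Suc k) * t))) sums (r * (1 - r\<^sup>2) * sin x / (1 - 2 * r * cos x + r\<^sup>2)\<^sup>2)"
      using sum_geometric_sin_ge(1)[OF r x] by simp
    from sums_diff[OF this B[of "\<lambda>k. exp (- (real (Suc k) * t))"]]
    have "(\<Sum>k. (A k - B k) * exp (- (real (Suc k) * t))) =
      r * (1 - r\<^sup>2) * sin x / (1 - 2 * r * cos x + r\<^sup>2)\<^sup>2 - (\<rho> / 16 * sin x * exp (- (1 * t)) - \<rho> ^ 3 / 16 * sin x * exp (- (3 * t)))"
      by (simp add: left_diff_distrib sums_iff)
    moreover have "\<rho> / 16 * sin x * exp (- (1 * t)) - \<rho> ^ 3 / 16 * sin x * exp (- (3 * t)) = (r - r ^ 3) / 16 * sin x"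
      using rk[of 3] by (simp add: r_def algebra_simps diff_divide_distrib)
    ultimately show "0 \<le> (\<Sum>k. (A k - B k) * exp (- (real (Suc k) * t)))"
      using sum_geometric_sin_ge(2)[OF r x] by linarith
  qed
  moreover have "summable (\<lambda>k. A k * real (Suc k) powr - s)"
    using s by (intro bdd) (auto simp: powr_minus inverse_le_1_iff ge_one_powr_ge_zero less_imp_le simp del: of_nat_Suc)
  then have "(\<lambda>k. (A k - B k) * real (Suc k) powr - s) sums
     ((\<Sum>k. A k * real (Suc k) powr - s) - (\<rho> / 16 * sin x * 1 powr - s - \<rho> ^ 3 / 16 * sin x * 3 powr - s))"
    using sums_diff[OF summable_sums B[of "\<lambda>k. real (Suc k) powr - s"]] by (simp add: left_diff_distrib)
  ultimately have "(\<Sum>k. A k * real (Suc k) powr - s) \<ge> \<rho> / 16 * sin x - \<rho> ^ 3 / 16 * sin x * 3 powr - s"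
    by (simp add: sums_iff)
  moreover have "A k * real (Suc k) powr - s = real (Suc k) powr (1 - s) * \<rho> ^ Suc k * sin (real (Suc k) * x)" for k
    by (simp add: A_def powr_diff powr_minus divide_inverse mult_ac del: of_nat_Suc)
  ultimately show ?thesis by (simp add: algebra_simps diff_divide_distrib)
qed

section \<open>Phases with one inflection point\<close>

text \<open>A lower bound on the second derivative integrates to the increment condition of
  \<open>van_der_corput_second\<close>; the opposite sign is reduced to this by conjugation.\<close>

lemma van_der_corput_curvature:
  fixes psi psi' psi'' :: "real \<Rightarrow> real"
  assumes ab: "a \<le> b"
    and der: "\<And>x. (psi has_real_derivative psi' x) (at x)"
    and der': "\<And>x. (psi' has_real_derivative psi'' x) (at x)"
    and l: "0 < l"
    and curv: "(\<forall>x\<in>{a..b}. psi'' x \<ge> l) \<or> (\<forall>x\<in>{a..b}. psi'' x \<le> - l)"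
  shows "norm (integral {a..b} (\<lambda>x. cis (psi x))) \<le> 18 / sqrt l"
proof -
  have main: "norm (integral {a..b} (\<lambda>x. cis (f x))) \<le> 18 / sqrt l"
    if d: "\<And>x. (f has_real_derivative f' x) (at x)" "\<And>x. (f' has_real_derivative f'' x) (at x)"
      and c: "\<And>x. x \<in> {a..b} \<Longrightarrow> f'' x \<ge> l" for f f' f'' :: "real \<Rightarrow> real"
  proof (rule van_der_corput_second[OF ab _ _ l])
    show "(f has_real_derivative f' x) (at x within {a..b})" for x
      by (rule has_field_derivative_at_within[OF d(1)])
    show "continuous_on {a..b} f'"
      using d(2) DERIV_isCont continuous_at_imp_continuous_on by blast
    show "l * (y - x) \<le> f' y - f' x" if xy: "a \<le> x" "x \<le> y" "y \<le> b" for x y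
    proof -
      have "f' x - l * x \<le> f' y - l * y"
      proof (rule DERIV_nonneg_imp_nondecreasing[OF xy(2)])
        fix z assume z: "x \<le> z" "z \<le> y"
        have "((\<lambda>x. f' x - l * x) has_real_derivative f'' z - l) (at z)"
          by (auto intro!: derivative_eq_intros d)
        moreover have "f'' z - l \<ge> 0" using c[of z] z xy by simp
        ultimately show "\<exists>y. ((\<lambda>x. f' x - l * x) has_real_derivative y) (at z) \<and> 0 \<le> y" by blast
      qed
      then show ?thesis by (simp add: algebra_simps)
    qed
  qed
  show ?thesis using curv
  proof
    assume "\<forall>x\<in>{a..b}. l \<le> psi'' x"
    then show ?thesis using main[OF der der'] by blast
  next
    assume *: "\<forall>x\<in>{a..b}. psi'' x \<le> - l"
    have "norm (integral {a..b} (\<lambda>x. cis (- psi x))) \<le> 18 / sqrt l"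
      by (rule main[where f'="\<lambda>x. - psi' x" and f''="\<lambda>x. - psi'' x"])
         (use * in \<open>force intro!: derivative_eq_intros der der'\<close>)+
    moreover have "continuous_on {a..b} psi"
      using der DERIV_isCont continuous_at_imp_continuous_on by blast
    ultimately show ?thesis using norm_integral_cis_minus[of a b psi "\<lambda>x. - psi x"] by simp
  qed
qed

text \<open>Jordan's inequality: the concave sine lies above its chord between 0 and
  \<open>pi / 2\<close>.\<close>

lemma sin_ge_linear:
  assumes "0 \<le> v" "v \<le> pi / 2"
  shows "2 / pi * v \<le> sin v"
proof -
  have "concave_on {0..pi} (sin :: real \<Rightarrow> real)"
    by (rule f''_le0_imp_concave[where f'=cos and f''="\<lambda>x. - sin x"])
       (auto intro!: derivative_eq_intros sin_ge_zero)
  from concave_onD[OF this, of "2 / pi * v" 0 "pi / 2"] assms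
  show ?thesis by (simp add: field_simps)
qed

text \<open>In the product formula for \<open>cos x - cos z\<close> the midpoint stays in
  \<open>[a / 2, pi - a / 2]\<close>, where the sine is at least \<open>sin (a / 2)\<close>. The
  half difference is at most \<open>pi / 2\<close>, so Jordan's inequality bounds the other
  factor.\<close>

lemma cos_diff_ge:
  assumes a: "0 < a" "a \<le> pi / 2" and z: "a \<le> z" "z \<le> pi - a" and x: "0 \<le> x" "x \<le> pi"
  shows "\<bar>cos x - cos z\<bar> \<ge> 2 / pi * sin (a / 2) * \<bar>x - z\<bar>"
proof -
  have s1: "sin ((x + z) / 2) \<ge> sin (a / 2)"
  proof (cases "(x + z) / 2 \<le> pi / 2")
    case True
    then show ?thesis using assms by (intro sin_monotone_2pi_le) auto
  next
    case False
    have "sin (pi - (x + z) / 2) \<ge> sin (a / 2)"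
      using False assms by (intro sin_monotone_2pi_le) (auto simp: field_simps)
    then show ?thesis by simp
  qed
  have "2 / pi * (\<bar>x - z\<bar> / 2) \<le> sin (\<bar>x - z\<bar> / 2)"
    using assms by (intro sin_ge_linear) auto
  also have "\<dots> \<le> \<bar>sin ((z - x) / 2)\<bar>"
  proof (cases "x \<le> z")
    case False
    then have "\<bar>x - z\<bar> / 2 = - ((z - x) / 2)" by argo
    then have "sin (\<bar>x - z\<bar> / 2) = - sin ((z - x) / 2)" by (simp only: sin_minus)
    then show ?thesis by simp
  qed simp
  finally have s2: "\<bar>sin ((z - x) / 2)\<bar> \<ge> 2 / pi * (\<bar>x - z\<bar> / 2)" .
  have s0: "sin (a / 2) \<ge> 0" using a by (intro sin_ge_zero) auto
  have "\<bar>cos x - cos z\<bar> = 2 * (sin ((x + z) / 2) * \<bar>sin ((z - x) / 2)\<bar>)"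
    using s0 s1 by (simp add: cos_diff_cos abs_mult)
  also have "\<dots> \<ge> 2 * (sin (a / 2) * (2 / pi * (\<bar>x - z\<bar> / 2)))"
    using s0 s1 s2 by (intro mult_left_mono mult_mono) auto
  finally show ?thesis by (simp add: mult_ac)
qed

text \<open>Here \<open>S\<close> and \<open>f\<close> are the velocity and the curvature belonging
  to \<open>\<sigma>\<close>, and \<open>f - \<gamma> cos\<close> is nonincreasing on
  \<open>[0, pi]\<close>. In the application \<open>\<gamma>\<close> and \<open>a\<close> do not
  depend on the regularization, so neither does the final bound.\<close>

context
  fixes \<sigma> S f :: "real \<Rightarrow> real" and \<gamma> a :: real
  assumes der: "\<And>x. (\<sigma> has_real_derivative S x) (at x)"
    and der': "\<And>x. (S has_real_derivative f x) (at x)"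
    and S0: "S 0 = 0" and Spi: "S pi = 0"
    and \<gamma>: "\<gamma> > 0"
    and f: "\<And>x y. 0 \<le> x \<Longrightarrow> x \<le> y \<Longrightarrow> y \<le> pi \<Longrightarrow> f x - f y \<ge> \<gamma> * (cos x - cos y)"
    and cf: "continuous_on {0..pi} f"
    and a: "0 < a" "a < 1" and Sa: "\<bar>S a\<bar> < \<gamma>" "\<bar>S (pi - a)\<bar> < \<gamma>"
begin

text \<open>
  If \<open>f a \<le> 0\<close>, then \<open>f\<close> is so negative on \<open>[a, \<pi>]\<close> that \<open>S \<pi> = 0\<close> forces \<open>S a \<ge> \<gamma>\<close>; similarly at
  the other end point.
\<close>

lemma inflection_point: "\<exists>z. a \<le> z \<and> z \<le> pi - a \<and> f z = 0"
proof -
  have pi: "pi > 3" using pi_gt3 .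
  have cosa: "cos a \<ge> 1/2"
  proof -
    have "cos a \<ge> cos (pi / 3)" using a pi by (intro cos_monotone_0_pi_le) auto
    then show ?thesis by (simp add: cos_60)
  qed
  have sa: "sin a > 0" using a pi by (intro sin_gt_zero) auto
  \<comment> \<open>From \<open>a < 1 < pi / 3\<close> one gets \<open>cos a \<ge> 1/2\<close> and
    \<open>pi - a > 2\<close>.\<close>
  have big: "sin a + (pi - a) * cos a \<ge> 1"
  proof -
    have "(pi - a) * cos a \<ge> 2 * (1/2)" using a pi cosa by (intro mult_mono) auto
    then show ?thesis using sa by linarith
  qed
  have fa: "f a > 0"
  proof (rule ccontr)
    assume "\<not> f a > 0"
    \<comment> \<open>This integrates \<open>f y \<le> - \<gamma> (cos a - cos y)\<close> over
      \<open>[a, pi]\<close>, by monotonicity of a primitive. The total is the quantity in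
      \<open>big\<close>.\<close>
    have "S pi + \<gamma> * (pi * cos a - sin pi) \<le> S a + \<gamma> * (a * cos a - sin a)"
    proof (rule DERIV_nonpos_imp_nonincreasing[of a pi "\<lambda>y. S y + \<gamma> * (y * cos a - sin y)"])
      fix y assume y: "a \<le> y" "y \<le> pi"
      have "((\<lambda>y. S y + \<gamma> * (y * cos a - sin y)) has_real_derivative f y + \<gamma> * (cos a - cos y)) (at y)"
        by (auto intro!: derivative_eq_intros der')
      moreover have "f y + \<gamma> * (cos a - cos y) \<le> 0" using f[of a y] y a \<open>\<not> f a > 0\<close> by linarith
      ultimately show "\<exists>d. ((\<lambda>y. S y + \<gamma> * (y * cos a - sin y)) has_real_derivative d) (at y) \<and> d \<le> 0" by blast
    qed (use a pi in auto)
    then have "\<gamma> * (sin a + (pi - a) * cos a) \<le> S a" by (simp add: Spi algebra_simps)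
    moreover have "\<gamma> * 1 \<le> \<gamma> * (sin a + (pi - a) * cos a)" using big \<gamma> by (intro mult_left_mono) auto
    ultimately show False using Sa by linarith
  qed
  have fb: "f (pi - a) < 0"
  proof (rule ccontr)
    assume "\<not> f (pi - a) < 0"
    \<comment> \<open>The mirrored argument on \<open>[0, pi - a]\<close>, with
      \<open>cos (pi - a) = - cos a\<close>.\<close>
    have "S 0 - \<gamma> * (sin 0 + 0 * cos a) \<le> S (pi - a) - \<gamma> * (sin (pi - a) + (pi - a) * cos a)"
    proof (rule DERIV_nonneg_imp_nondecreasing[of 0 "pi - a" "\<lambda>y. S y - \<gamma> * (sin y + y * cos a)"])
      fix y assume y: "0 \<le> y" "y \<le> pi - a"
      have "((\<lambda>y. S y - \<gamma> * (sin y + y * cos a)) has_real_derivative f y - \<gamma> * (cos y + cos a)) (at y)"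
        by (auto intro!: derivative_eq_intros der')
      moreover have "f y - \<gamma> * (cos y + cos a) \<ge> 0"
        using f[of y "pi - a"] y a \<open>\<not> f (pi - a) < 0\<close> by simp
      ultimately show "\<exists>d. ((\<lambda>y. S y - \<gamma> * (sin y + y * cos a)) has_real_derivative d) (at y) \<and> 0 \<le> d" by blast
    qed (use a pi in auto)
    then have "\<gamma> * (sin a + (pi - a) * cos a) \<le> S (pi - a)" by (simp add: S0)
    moreover have "\<gamma> * 1 \<le> \<gamma> * (sin a + (pi - a) * cos a)" using big \<gamma> by (intro mult_left_mono) auto
    ultimately show False using Sa by linarith
  qed
  have "continuous_on {a..pi - a} f" by (rule continuous_on_subset[OF cf]) (use a in auto)
  then show ?thesis
    using IVT2'[of f "pi - a" 0 a] fa fb a pi by auto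
qed

text \<open>A window of radius \<open>\<delta>\<close> around the zero \<open>z\<close> of the
  curvature is bounded by its length. Outside it the phase has curvature at least
  \<open>l = t \<gamma> \<kappa> \<delta>\<close> in size, so each side contributes at most
  \<open>18 / sqrt l\<close>.\<close>

lemma oscillatory_bound_inflection:
  assumes t: "t > 0"
  shows "norm (integral {0..pi} (\<lambda>x. cis (c * x - t * \<sigma> x)))
    \<le> (2 + 36 / sqrt (\<gamma> * (2 / pi * sin (a / 2)))) * t powr - (1/3)"
proof -
  obtain z where z: "a \<le> z" "z \<le> pi - a" "f z = 0" using inflection_point by blast
  define \<kappa> where "\<kappa> = 2 / pi * sin (a / 2)"
  have pi: "pi > 3" using pi_gt3 .
  have "sin (a / 2) > 0" using a pi by (intro sin_gt_zero) auto
  then have \<kappa>: "\<kappa> > 0" by (simp add: \<kappa>_def)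
  \<comment> \<open>This choice balances the pieces:
    \<open>t * \<delta> = 1 / \<delta>\<^sup>2\<close>, so \<open>1 / sqrt l\<close> is a constant
    multiple of \<open>\<delta>\<close>.\<close>
  define \<delta> where "\<delta> = t powr - (1/3)"
  have \<delta>: "\<delta> > 0" using t by (simp add: \<delta>_def)
  define l where "l = t * (\<gamma> * \<kappa> * \<delta>)"
  have l: "l > 0" using t \<gamma> \<kappa> \<delta> by (simp add: l_def)
  define P where "P = (\<lambda>x. c * x - t * \<sigma> x)"
  have dP: "(P has_real_derivative c - t * S x) (at x)" for x
    unfolding P_def by (auto intro!: derivative_eq_intros der)
  have dP': "((\<lambda>x. c - t * S x) has_real_derivative - (t * f x)) (at x)" for x
    by (auto intro!: derivative_eq_intros der')
  have contP: "continuous_on A P" for A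
    using dP DERIV_isCont continuous_at_imp_continuous_on by blast
  have left: "f x \<ge> \<gamma> * (\<kappa> * (z - x))" if "0 \<le> x" "x \<le> z" for x
  proof -
    have "cos x \<ge> cos z" using that z a by (intro cos_monotone_0_pi_le) auto
    then have "cos x - cos z \<ge> \<kappa> * (z - x)"
      using cos_diff_ge[of a z x] that z a pi by (simp add: \<kappa>_def)
    then have "\<gamma> * (cos x - cos z) \<ge> \<gamma> * (\<kappa> * (z - x))" using \<gamma> by (intro mult_left_mono) auto
    then show ?thesis using f[of x z] that z a by simp
  qed
  have right: "f x \<le> - (\<gamma> * (\<kappa> * (x - z)))" if "z \<le> x" "x \<le> pi" for x
  proof -
    have "cos x \<le> cos z" using that z a by (intro cos_monotone_0_pi_le) auto
    then have "cos z - cos x \<ge> \<kappa> * (x - z)"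
      using cos_diff_ge[of a z x] that z a pi by (simp add: \<kappa>_def)
    then have "\<gamma> * (cos z - cos x) \<ge> \<gamma> * (\<kappa> * (x - z))" using \<gamma> by (intro mult_left_mono) auto
    then show ?thesis using f[of z x] that z a by simp
  qed
  \<comment> \<open>The window is clipped to \<open>[0, pi]\<close>; when it reaches an end point,
    the outer piece on that side degenerates to a point.\<close>
  define u where "u = max 0 (z - \<delta>)"
  define v where "v = min pi (z + \<delta>)"
  have uv: "0 \<le> u" "u \<le> z" "z \<le> v" "v \<le> pi" "v - u \<le> 2 * \<delta>"
    using z a \<delta> by (auto simp: u_def v_def)
  have I: "(\<lambda>x. cis (P x)) integrable_on {p..q}" for p q
    by (intro integrable_continuous_real continuous_intros contP)
  have split: "integral {0..pi} (\<lambda>x. cis (P x)) =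
     integral {0..u} (\<lambda>x. cis (P x)) + integral {u..v} (\<lambda>x. cis (P x)) + integral {v..pi} (\<lambda>x. cis (P x))"
    using Henstock_Kurzweil_Integration.integral_combine[of 0 u pi "\<lambda>x. cis (P x)"]
      Henstock_Kurzweil_Integration.integral_combine[of u v pi "\<lambda>x. cis (P x)"] uv I by (simp add: add.assoc)
  have scale: "t * (\<gamma> * (\<kappa> * w)) \<ge> l" if "w \<ge> \<delta>" for w
  proof -
    have "t * (\<gamma> * (\<kappa> * \<delta>)) \<le> t * (\<gamma> * (\<kappa> * w))"
      using that t \<gamma> \<kappa> by (intro mult_left_mono) auto
    then show ?thesis by (simp add: l_def mult_ac)
  qed
  have "norm (integral {0..u} (\<lambda>x. cis (P x))) \<le> 18 / sqrt l"
  proof (cases "z \<le> \<delta>")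
    case True
    then show ?thesis using l by (simp add: u_def)
  next
    case False
    show ?thesis
    proof (rule van_der_corput_curvature[OF uv(1) dP dP' l], rule disjI2, intro ballI)
      fix x assume x: "x \<in> {0..u}"
      have "t * f x \<ge> t * (\<gamma> * (\<kappa> * (z - x)))" using left[of x] x uv t by (intro mult_left_mono) auto
      moreover have "t * (\<gamma> * (\<kappa> * (z - x))) \<ge> l" using x False by (intro scale) (auto simp: u_def)
      ultimately show "- (t * f x) \<le> - l" by linarith
    qed
  qed
  moreover have "norm (integral {v..pi} (\<lambda>x. cis (P x))) \<le> 18 / sqrt l"
  proof (cases "z + \<delta> \<ge> pi")
    case True
    then show ?thesis using l by (simp add: v_def)
  next
    case False
    show ?thesis
    proof (rule van_der_corput_curvature[OF uv(4) dP dP' l], rule disjI1, intro ballI)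
      fix x assume x: "x \<in> {v..pi}"
      have "t * f x \<le> t * - (\<gamma> * (\<kappa> * (x - z)))" using right[of x] x uv t by (intro mult_left_mono) auto
      moreover have "t * (\<gamma> * (\<kappa> * (x - z))) \<ge> l" using x False by (intro scale) (auto simp: v_def)
      ultimately show "- (t * f x) \<ge> l" by linarith
    qed
  qed
  moreover have "norm (integral {u..v} (\<lambda>x. cis (P x))) \<le> 2 * \<delta>"
    using norm_integral_cis_le[OF contP, of u v] uv by linarith
  ultimately have "norm (integral {0..pi} (\<lambda>x. cis (P x))) \<le> 18 / sqrt l + 2 * \<delta> + 18 / sqrt l"
    unfolding split by (smt (verit) norm_triangle_ineq)
  also have "sqrt l = sqrt (\<gamma> * \<kappa>) / \<delta>"
  proof -
    have "t * \<delta> = 1 / \<delta>\<^sup>2"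
    proof -
      have "t * \<delta> * \<delta>\<^sup>2 = t powr 1 * (t powr - (1/3) * (t powr - (1/3) * t powr - (1/3)))"
        using t by (simp add: \<delta>_def power2_eq_square)
      also have "\<dots> = 1" using t by (simp flip: powr_add)
      finally show ?thesis using \<delta> by (simp add: field_simps)
    qed
    moreover have "l = \<gamma> * \<kappa> * (t * \<delta>)" by (simp add: l_def)
    ultimately have "l = (\<gamma> * \<kappa>) / \<delta>\<^sup>2" by simp
    then show ?thesis using \<delta> by (simp add: real_sqrt_divide)
  qed
  also have "18 / (sqrt (\<gamma> * \<kappa>) / \<delta>) + 2 * \<delta> + 18 / (sqrt (\<gamma> * \<kappa>) / \<delta>) = (2 + 36 / sqrt (\<gamma> * \<kappa>)) * \<delta>"
    using \<delta> by (simp add: field_simps)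
  finally show ?thesis by (simp add: P_def \<kappa>_def \<delta>_def)
qed

end

section \<open>Dispersion with an inflection point\<close>

lemma DERIV_suminf:
  fixes g g' :: "nat \<Rightarrow> real \<Rightarrow> real"
  assumes der: "\<And>k x. (g k has_real_derivative g' k x) (at x)"
    and bd: "\<And>k x. \<bar>g' k x\<bar> \<le> M k" and M: "summable M" and s0: "summable (\<lambda>k. g k 0)"
  shows "((\<lambda>x. \<Sum>k. g k x) has_real_derivative (\<Sum>k. g' k x)) (at x)"
proof -
  have u: "uniformly_convergent_on UNIV (\<lambda>n x. \<Sum>i<n. g' i x)"
    by (rule Weierstrass_m_test'[OF _ M]) (use bd in simp)
  have d: "(g k has_real_derivative g' k x) (at x within UNIV)" for k x using der by simp
  show ?thesis
    using has_field_derivative_series'(2)[OF convex_UNIV d u UNIV_I s0] by simp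
qed

section \<open>Abel regularization of the dispersion and its derivatives\<close>

definition abel_weight :: "real \<Rightarrow> real \<Rightarrow> nat \<Rightarrow> real" where
  "abel_weight \<rho> p k = real (Suc k) powr p * \<rho> ^ Suc k"

text \<open>Each termwise differentiation brings out a factor \<open>Suc k\<close> and so raises the
  exponent \<open>p\<close> by one.\<close>

lemma abel_weight_Suc: "abel_weight \<rho> p k * real (Suc k) = abel_weight \<rho> (p + 1) k"
  by (simp add: abel_weight_def powr_add del: of_nat_Suc)

text \<open>Comparison with the series of \<open>k * \<rho> ^ k\<close>. The largest exponent that
  occurs below is \<open>2 - \<alpha>\<close>, from the derivative of the curvature.\<close>

lemma summable_abel_weight:
  assumes \<rho>: "0 < \<rho>" "\<rho> < 1" and p: "p \<le> 1"
  shows "summable (abel_weight \<rho> p)"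
proof -
  have g: "summable (\<lambda>k. real (Suc k) * \<rho> ^ Suc k)"
    using summable_mult[OF sums_summable[OF geometric_deriv_sums[of \<rho>]], of \<rho>] \<rho> by (simp add: mult_ac)
  show ?thesis
  proof (rule summable_comparison_test'[OF g])
    fix k
    have "real (Suc k) powr p \<le> real (Suc k) powr 1" using p by (intro powr_mono) auto
    then show "norm (abel_weight \<rho> p k) \<le> real (Suc k) * \<rho> ^ Suc k"
      using \<rho> by (simp add: abel_weight_def mult_right_mono del: of_nat_Suc power_Suc)
  qed
qed

lemma abel_weight_nonneg: "0 < \<rho> \<Longrightarrow> 0 \<le> abel_weight \<rho> p k"
  by (simp add: abel_weight_def)

context
  fixes \<alpha> :: real
  assumes \<alpha>: "\<alpha> > 1"
begin

definition abel_dispersion :: "real \<Rightarrow> real \<Rightarrow> real" where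
  "abel_dispersion \<rho> x = (\<Sum>k. 2 * abel_weight \<rho> (- 1 - \<alpha>) k * (1 - cos (real (Suc k) * x)))"

definition abel_velocity :: "real \<Rightarrow> real \<Rightarrow> real" where
  "abel_velocity \<rho> x = (\<Sum>k. 2 * abel_weight \<rho> (- \<alpha>) k * sin (real (Suc k) * x))"

definition abel_curvature :: "real \<Rightarrow> real \<Rightarrow> real" where
  "abel_curvature \<rho> x = (\<Sum>k. 2 * abel_weight \<rho> (1 - \<alpha>) k * cos (real (Suc k) * x))"

context
  fixes \<rho> :: real
  assumes \<rho>: "0 < \<rho>" "\<rho> < 1"
begin

lemma abel_trig_le:
  "\<bar>y\<bar> \<le> 1 \<Longrightarrow> \<bar>2 * abel_weight \<rho> p k * y\<bar> \<le> 2 * abel_weight \<rho> p k"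
  using abel_weight_nonneg[OF \<rho>(1), of p k] mult_left_le[of "\<bar>y\<bar>" "2 * abel_weight \<rho> p k"]
  by (simp add: abs_mult)

lemma DERIV_abel_dispersion: "(abel_dispersion \<rho> has_real_derivative abel_velocity \<rho> x) (at x)"
  unfolding abel_dispersion_def[abs_def] abel_velocity_def
proof (rule DERIV_suminf)
  fix k x
  show "((\<lambda>x. 2 * abel_weight \<rho> (- 1 - \<alpha>) k * (1 - cos (real (Suc k) * x))) has_real_derivative
      2 * abel_weight \<rho> (- \<alpha>) k * sin (real (Suc k) * x)) (at x)"
    using abel_weight_Suc[of \<rho> "- 1 - \<alpha>" k] by (auto intro!: derivative_eq_intros simp: mult_ac simp del: of_nat_Suc)
  show "\<bar>2 * abel_weight \<rho> (- \<alpha>) k * sin (real (Suc k) * x)\<bar> \<le> 2 * abel_weight \<rho> (- \<alpha>) k"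
    by (intro abel_trig_le) simp
qed (use \<alpha> \<rho> in \<open>auto intro!: summable_mult summable_abel_weight\<close>)

lemma DERIV_abel_velocity: "(abel_velocity \<rho> has_real_derivative abel_curvature \<rho> x) (at x)"
  unfolding abel_velocity_def[abs_def] abel_curvature_def
proof (rule DERIV_suminf)
  fix k x
  show "((\<lambda>x. 2 * abel_weight \<rho> (- \<alpha>) k * sin (real (Suc k) * x)) has_real_derivative
      2 * abel_weight \<rho> (1 - \<alpha>) k * cos (real (Suc k) * x)) (at x)"
    using abel_weight_Suc[of \<rho> "- \<alpha>" k] by (auto intro!: derivative_eq_intros simp: mult_ac simp del: of_nat_Suc)
  show "\<bar>2 * abel_weight \<rho> (1 - \<alpha>) k * cos (real (Suc k) * x)\<bar> \<le> 2 * abel_weight \<rho> (1 - \<alpha>) k"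
    by (intro abel_trig_le) simp
qed (use \<alpha> \<rho> in \<open>auto intro!: summable_mult summable_abel_weight\<close>)

lemma DERIV_abel_curvature:
  "(abel_curvature \<rho> has_real_derivative (\<Sum>k. - (2 * abel_weight \<rho> (2 - \<alpha>) k * sin (real (Suc k) * x)))) (at x)"
  unfolding abel_curvature_def[abs_def]
proof (rule DERIV_suminf)
  fix k x
  show "((\<lambda>x. 2 * abel_weight \<rho> (1 - \<alpha>) k * cos (real (Suc k) * x)) has_real_derivative
      - (2 * abel_weight \<rho> (2 - \<alpha>) k * sin (real (Suc k) * x))) (at x)"
    using abel_weight_Suc[of \<rho> "1 - \<alpha>" k] by (auto intro!: derivative_eq_intros simp: mult_ac simp del: of_nat_Suc)
  show "\<bar>- (2 * abel_weight \<rho> (2 - \<alpha>) k * sin (real (Suc k) * x))\<bar> \<le> 2 * abel_weight \<rho> (2 - \<alpha>) k"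
    unfolding abs_minus_cancel by (intro abel_trig_le) simp
qed (use \<alpha> \<rho> in \<open>auto intro!: summable_mult summable_abel_weight\<close>)

text \<open>The derivative of the curvature is \<open>- 2\<close> times the sine series bounded
  below in \<open>sum_powr_sin_ge\<close> with \<open>s = \<alpha> - 1\<close>. From
  \<open>\<rho> ^ 3 \<le> \<rho>\<close> and \<open>\<rho> \<ge> 1/2\<close> comes a constant that
  is free of \<open>\<rho>\<close>.\<close>

lemma abel_curvature_decrease:
  assumes half: "\<rho> \<ge> 1/2" and xy: "0 \<le> x" "x \<le> y" "y \<le> pi"
  shows "abel_curvature \<rho> x - abel_curvature \<rho> y \<ge> (1 - 3 powr (1 - \<alpha>)) / 16 * (cos x - cos y)"
proof -
  define \<gamma> where "\<gamma> = (1 - 3 powr (1 - \<alpha>)) / 16"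
  have "abel_curvature \<rho> y - \<gamma> * cos y \<le> abel_curvature \<rho> x - \<gamma> * cos x"
  proof (rule DERIV_nonpos_imp_nonincreasing[OF xy(2)])
    fix z assume z: "x \<le> z" "z \<le> y"
    have d: "((\<lambda>x. abel_curvature \<rho> x - \<gamma> * cos x) has_real_derivative
        (\<Sum>k. - (2 * abel_weight \<rho> (2 - \<alpha>) k * sin (real (Suc k) * z))) + \<gamma> * sin z) (at z)"
      by (auto intro!: derivative_eq_intros DERIV_abel_curvature)
    have sm: "summable (\<lambda>k. abel_weight \<rho> (2 - \<alpha>) k * sin (real (Suc k) * z))"
      using \<alpha> \<rho> abel_weight_nonneg[OF \<rho>(1)]
      by (intro summable_comparison_test'[OF summable_abel_weight[of \<rho> "2 - \<alpha>"]])
         (auto simp: abs_mult mult_left_le simp del: of_nat_Suc)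
    have "(\<Sum>k. - (2 * abel_weight \<rho> (2 - \<alpha>) k * sin (real (Suc k) * z)))
        = - 2 * (\<Sum>k. abel_weight \<rho> (2 - \<alpha>) k * sin (real (Suc k) * z))"
      using suminf_mult[OF sm, of "-2"] by (simp add: mult.assoc)
    moreover have "(\<Sum>k. abel_weight \<rho> (2 - \<alpha>) k * sin (real (Suc k) * z))
        \<ge> (\<rho> - \<rho> ^ 3 * 3 powr - (\<alpha> - 1)) / 16 * sin z"
      using sum_powr_sin_ge[OF \<rho>, of z "\<alpha> - 1"] z xy \<alpha> by (simp add: abel_weight_def)
    moreover have "2 * ((\<rho> - \<rho> ^ 3 * 3 powr - (\<alpha> - 1)) / 16 * sin z) \<ge> \<gamma> * sin z"
    proof -
      define q where "q = (3::real) powr (1 - \<alpha>)"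
      have q: "0 \<le> q" "q < 1" using \<alpha> powr_less_mono[of "1 - \<alpha>" 0 "3::real"] by (auto simp: q_def)
      have "\<rho> ^ 3 \<le> \<rho>" using \<rho> by (simp add: power_le_one_iff self_le_power power_decreasing[of 1 3 \<rho>, simplified])
      then have "\<rho> ^ 3 * q \<le> \<rho> * q" using q by (intro mult_right_mono) auto
      moreover have "(1/2) * (1 - q) \<le> \<rho> * (1 - q)" using half q by (intro mult_right_mono) auto
      moreover have "\<rho> * (1 - q) = \<rho> - \<rho> * q" "\<gamma> = (1 - q) / 16"
        by (simp_all add: \<gamma>_def q_def right_diff_distrib)
      ultimately have "\<gamma> \<le> 2 * ((\<rho> - \<rho> ^ 3 * q) / 16)" by argo
      then have "\<gamma> * sin z \<le> 2 * ((\<rho> - \<rho> ^ 3 * q) / 16) * sin z"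
        using z xy by (intro mult_right_mono sin_ge_zero) auto
      then show ?thesis by (simp only: q_def minus_diff_eq mult.assoc)
    qed
    ultimately have "(\<Sum>k. - (2 * abel_weight \<rho> (2 - \<alpha>) k * sin (real (Suc k) * z))) + \<gamma> * sin z \<le> 0"
      by linarith
    with d show "\<exists>d. ((\<lambda>x. abel_curvature \<rho> x - \<gamma> * cos x) has_real_derivative d) (at z) \<and> d \<le> 0" by blast
  qed
  then show ?thesis unfolding \<gamma>_def[symmetric] right_diff_distrib by linarith
qed

text \<open>Replacing \<open>\<rho> ^ Suc k\<close> by 1 gives a majorant that no longer depends on
  \<open>\<rho>\<close>.\<close>

lemma abel_velocity_bound:
  "\<bar>abel_velocity \<rho> x\<bar> \<le> (\<Sum>k. 2 * real (Suc k) powr - \<alpha> * \<bar>sin (real (Suc k) * x)\<bar>)"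
proof -
  have "norm (\<Sum>k. 2 * abel_weight \<rho> (- \<alpha>) k * sin (real (Suc k) * x))
    \<le> (\<Sum>k. 2 * real (Suc k) powr - \<alpha> * \<bar>sin (real (Suc k) * x)\<bar>)"
  proof (rule norm_suminf_le)
    fix k
    have "real (Suc k) powr - \<alpha> * \<rho> ^ Suc k \<le> real (Suc k) powr - \<alpha> * 1"
      using \<rho> by (intro mult_left_mono power_le_one) auto
    then show "norm (2 * abel_weight \<rho> (- \<alpha>) k * sin (real (Suc k) * x)) \<le> 2 * real (Suc k) powr - \<alpha> * \<bar>sin (real (Suc k) * x)\<bar>"
      using \<rho> by (simp add: abel_weight_def abs_mult mult_right_mono del: of_nat_Suc power_Suc)
  next
    show "summable (\<lambda>k. 2 * real (Suc k) powr - \<alpha> * \<bar>sin (real (Suc k) * x)\<bar>)"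
      by (rule summable_comparison_test'[OF summable_mult[OF summable_Suc_powr[of "- \<alpha>"], of 2]])
         (use \<alpha> in \<open>auto simp: abs_mult mult_left_le simp del: of_nat_Suc\<close>)
  qed
  then show ?thesis by (simp add: abel_velocity_def)
qed

end

text \<open>For \<open>\<alpha> > 1\<close> the majorant \<open>G\<close> is a uniform limit of
  continuous functions with \<open>G 0 = 0\<close>, hence small near 0. The symmetry
  \<open>G (pi - a) = G a\<close> lets one \<open>a\<close> serve both end points, for all
  \<open>\<rho>\<close> at once.\<close>

lemma velocity_majorant_small:
  assumes "\<epsilon> > 0"
  obtains a where "0 < a" "a < 1"
    "\<And>\<rho>. 0 < \<rho> \<Longrightarrow> \<rho> < 1 \<Longrightarrow> \<bar>abel_velocity \<rho> a\<bar> < \<epsilon>"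
    "\<And>\<rho>. 0 < \<rho> \<Longrightarrow> \<rho> < 1 \<Longrightarrow> \<bar>abel_velocity \<rho> (pi - a)\<bar> < \<epsilon>"
proof -
  define G where "G = (\<lambda>x. \<Sum>k. 2 * real (Suc k) powr - \<alpha> * \<bar>sin (real (Suc k) * x)\<bar>)"
  have "uniform_limit UNIV (\<lambda>n x. \<Sum>k<n. 2 * real (Suc k) powr - \<alpha> * \<bar>sin (real (Suc k) * x)\<bar>) G sequentially"
    unfolding G_def
    by (rule Weierstrass_m_test[OF _ summable_mult[OF summable_Suc_powr[of "- \<alpha>"], of 2]])
       (use \<alpha> in \<open>auto simp: abs_mult mult_left_le simp del: of_nat_Suc\<close>)
  then have "continuous_on UNIV G"
    by (rule uniform_limit_theorem[rotated])
       (auto intro!: always_eventually continuous_intros simp del: of_nat_Suc)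
  then have "isCont G 0" by (simp add: continuous_on_eq_continuous_at)
  moreover have "G 0 = 0" by (simp add: G_def)
  ultimately have "G \<midarrow>0\<rightarrow> 0" by (simp add: isCont_def)
  then have "eventually (\<lambda>x. G x < \<epsilon>) (at_right 0)"
    using assms by (intro order_tendstoD(2) filterlim_at_split[THEN iffD1, THEN conjunct2]) auto
  moreover have "eventually (\<lambda>x::real. x < 1) (at_right 0)" by (intro eventually_at_rightI[of 0 1]) auto
  moreover have "eventually (\<lambda>x::real. 0 < x) (at_right 0)" by (rule eventually_at_right_less)
  ultimately have "eventually (\<lambda>x. G x < \<epsilon> \<and> x < 1 \<and> 0 < x) (at_right 0)" by eventually_elim simp
  from eventually_happens'[OF trivial_limit_at_right_real this]
  obtain a where a: "G a < \<epsilon>" "a < 1" "0 < a" by blast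
  have "\<bar>sin (real (Suc k) * (pi - a))\<bar> = \<bar>sin (real (Suc k) * a)\<bar>" for k
  proof -
    have "sin (real (Suc k) * (pi - a)) = sin (real (Suc k) * pi - real (Suc k) * a)" by (simp only: right_diff_distrib)
    also have "\<dots> = - ((-1) ^ Suc k * sin (real (Suc k) * a))"
      by (simp add: sin_diff sin_npi cos_npi del: of_nat_Suc power_Suc)
    finally show ?thesis by (simp add: abs_mult power_abs)
  qed
  then have Gpi: "G (pi - a) = G a" by (simp only: G_def)
  have bound: "\<bar>abel_velocity \<rho> x\<bar> \<le> G x" if "0 < \<rho>" "\<rho> < 1" for \<rho> x
    unfolding G_def by (rule abel_velocity_bound[OF that])
  show ?thesis
  proof (rule that[of a])
    fix \<rho> :: real assume \<rho>: "0 < \<rho>" "\<rho> < 1"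
    show "\<bar>abel_velocity \<rho> a\<bar> < \<epsilon>" using bound[OF \<rho>, of a] a by linarith
    show "\<bar>abel_velocity \<rho> (pi - a)\<bar> < \<epsilon>" using bound[OF \<rho>, of "pi - a"] a Gpi by linarith
  qed (use a in auto)
qed

lemma oscillatory_bound_cube_root:
  obtains K where "K > 0"
    "\<And>t c. t > 0 \<Longrightarrow> norm (integral {0..pi} (\<lambda>x. cis (c * x - t * dispersion \<alpha> x))) \<le> K * t powr - (1/3)"
proof -
  define \<gamma> where "\<gamma> = (1 - 3 powr (1 - \<alpha>)) / 16"
  have \<gamma>: "\<gamma> > 0" using \<alpha> powr_less_mono[of "1 - \<alpha>" 0 "3::real"] by (simp add: \<gamma>_def)
  obtain a where a: "0 < a" "a < 1"
    and Sa: "\<And>\<rho>. 0 < \<rho> \<Longrightarrow> \<rho> < 1 \<Longrightarrow> \<bar>abel_velocity \<rho> a\<bar> < \<gamma>"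
    and Sb: "\<And>\<rho>. 0 < \<rho> \<Longrightarrow> \<rho> < 1 \<Longrightarrow> \<bar>abel_velocity \<rho> (pi - a)\<bar> < \<gamma>"
    using velocity_majorant_small[OF \<gamma>] by blast
  define K where "K = 2 + 36 / sqrt (\<gamma> * (2 / pi * sin (a / 2)))"
  have "sin (a / 2) > 0" using a pi_gt3 by (intro sin_gt_zero) auto
  then have K: "K > 0" using \<gamma> by (simp add: K_def add_pos_nonneg)
  \<comment> \<open>The shift by 2 starts the sequence at \<open>1/2\<close>, as
    \<open>abel_curvature_decrease\<close> requires.\<close>
  define r where "r = (\<lambda>j. 1 - 1 / real (j + 2))"
  have r: "1/2 \<le> r j" "0 < r j" "r j < 1" for j by (auto simp: r_def field_simps)
  have r1: "r \<longlonglongrightarrow> 1"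
  proof -
    have "(\<lambda>j. 1 - 1 / real (j + 2)) \<longlonglongrightarrow> 1 - 0"
      by (intro tendsto_intros LIMSEQ_ignore_initial_segment[OF lim_1_over_n, of 2])
    then show ?thesis by (simp add: r_def)
  qed
  have "norm (integral {0..pi} (\<lambda>x. cis (c * x - t * dispersion \<alpha> x))) \<le> K * t powr - (1/3)"
    if t: "t > 0" for t c
  proof (rule norm_integral_cis_limit[where P="\<lambda>j x. c * x - t * abel_dispersion (r j) x"])
    show "continuous_on {0..pi} (\<lambda>x. c * x - t * abel_dispersion (r j) x)" for j
      using DERIV_abel_dispersion[OF r(2,3)] DERIV_isCont continuous_at_imp_continuous_on
      by (intro continuous_intros) blast
    show "(\<lambda>j. c * x - t * abel_dispersion (r j) x) \<longlonglongrightarrow> c * x - t * dispersion \<alpha> x" for x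
    proof (intro tendsto_intros)
      show "(\<lambda>j. abel_dispersion (r j) x) \<longlonglongrightarrow> dispersion \<alpha> x"
        unfolding abel_dispersion_def dispersion_def
      proof (rule tannerys_theorem[THEN conjunct2, THEN conjunct2])
        have e: "- 1 - \<alpha> = - (1 + \<alpha>)" by simp
        show "(\<lambda>j. 2 * abel_weight (r j) (- 1 - \<alpha>) k * (1 - cos (real (Suc k) * x)))
            \<longlonglongrightarrow> 2 * real (Suc k) powr - (1 + \<alpha>) * (1 - cos (real (Suc k) * x))" for k
        proof -
          have "(\<lambda>j. 2 * (real (Suc k) powr - (1 + \<alpha>) * r j ^ Suc k) * (1 - cos (real (Suc k) * x)))
            \<longlonglongrightarrow> 2 * (real (Suc k) powr - (1 + \<alpha>) * 1 ^ Suc k) * (1 - cos (real (Suc k) * x))"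
            by (intro tendsto_intros r1)
          then show ?thesis unfolding abel_weight_def e by simp
        qed
        have "norm (2 * abel_weight (r j) (- 1 - \<alpha>) k * (1 - cos (real (Suc k) * x))) \<le> 4 * real (Suc k) powr - (1 + \<alpha>)" for k j
        proof -
          have "norm (2 * abel_weight (r j) (- 1 - \<alpha>) k * (1 - cos (real (Suc k) * x)))
              = r j ^ Suc k * norm (2 * real (Suc k) powr - (1 + \<alpha>) * (1 - cos (real (Suc k) * x)))"
            unfolding abel_weight_def e using r(2)[of j] by (simp add: abs_mult mult_ac del: of_nat_Suc power_Suc)
          also have "\<dots> \<le> 1 * norm (2 * real (Suc k) powr - (1 + \<alpha>) * (1 - cos (real (Suc k) * x)))"
            using r(2,3)[of j] by (intro mult_right_mono power_le_one) auto
          finally show ?thesis using norm_dispersion_term_le[of k "- (1 + \<alpha>)" "real (Suc k) * x"] by linarith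
        qed
        then show "\<forall>\<^sub>F (k, j) in at_top \<times>\<^sub>F sequentially.
            norm (2 * abel_weight (r j) (- 1 - \<alpha>) k * (1 - cos (real (Suc k) * x))) \<le> 4 * real (Suc k) powr - (1 + \<alpha>)"
          by (intro always_eventually) auto
        show "summable (\<lambda>k. 4 * real (Suc k) powr - (1 + \<alpha>))"
          using \<alpha> by (intro summable_mult summable_Suc_powr) auto
      qed simp
    qed
    show "eventually (\<lambda>j. norm (integral {0..pi} (\<lambda>x. cis (c * x - t * abel_dispersion (r j) x))) \<le> K * t powr - (1/3)) sequentially"
    proof (intro always_eventually allI)
      fix j
      show "norm (integral {0..pi} (\<lambda>x. cis (c * x - t * abel_dispersion (r j) x))) \<le> K * t powr - (1/3)"
        unfolding K_def
      proof (rule oscillatory_bound_inflection[OF DERIV_abel_dispersion[OF r(2,3)] DERIV_abel_velocity[OF r(2,3)] _ _ \<gamma> _ _ a Sa[OF r(2,3)] Sb[OF r(2,3)] t])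
        show "abel_velocity (r j) 0 = 0" by (simp add: abel_velocity_def)
        show "abel_velocity (r j) pi = 0" unfolding abel_velocity_def sin_npi by simp
        show "\<gamma> * (cos x - cos y) \<le> abel_curvature (r j) x - abel_curvature (r j) y" if "0 \<le> x" "x \<le> y" "y \<le> pi" for x y
          unfolding \<gamma>_def by (rule abel_curvature_decrease[OF r(2,3,1) that])
        show "continuous_on {0..pi} (abel_curvature (r j))"
          using DERIV_abel_curvature[OF r(2,3)] DERIV_isCont continuous_at_imp_continuous_on by blast
      qed
    qed
  qed
  then show ?thesis using that[OF K] by blast
qed

end

section \<open>Decay of the kernel\<close>

text \<open>The nonzero integers are split into positive and negative ones. Adding the terms at
  \<open>k\<close> and \<open>- k\<close> cancels the imaginary parts and leaves
  \<open>2 (1 - cos (k x))\<close>.\<close>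

lemma power_law_coupling_has_sum:
  assumes "\<alpha> > 0"
  shows "(\<lambda>j. \<bar>power_law_coupling \<alpha> j\<bar>) summable_on UNIV"
    and "\<And>x. ((\<lambda>j. of_real (power_law_coupling \<alpha> j) * (1 - cis (- (of_int j * x)))) has_sum complex_of_real (dispersion \<alpha> x)) (UNIV - {0})"
proof -
  define J where "J = power_law_coupling \<alpha>"
  define P where "P = (\<lambda>k. int (Suc k))"
  define N where "N = (\<lambda>k. - int (Suc k))"
  have inj: "inj P" "inj N" by (auto simp: P_def N_def inj_def)
  have U: "UNIV - {0} = range P \<union> range N" "range P \<inter> range N = {}"
  proof -
    show "UNIV - {0} = range P \<union> range N"
    proof (intro set_eqI iffI)
      fix j :: int assume "j \<in> UNIV - {0}"
      then have "j = P (nat (j - 1)) \<or> j = N (nat (- j - 1))" by (auto simp: P_def N_def)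
      then show "j \<in> range P \<union> range N" by blast
    qed (auto simp: P_def N_def)
  qed (auto simp: P_def N_def)
  have J: "J (P k) = real (Suc k) powr - (1 + \<alpha>)" "J (N k) = real (Suc k) powr - (1 + \<alpha>)" for k
    by (simp_all add: J_def power_law_coupling_def P_def N_def add.commute)
  have sm: "summable (\<lambda>k. real (Suc k) powr - (1 + \<alpha>))" using assms by (intro summable_Suc_powr) auto
  have so: "(\<lambda>k. real (Suc k) powr - (1 + \<alpha>)) summable_on UNIV"
    using sm by (intro norm_summable_imp_summable_on) simp
  have "(\<lambda>j. \<bar>J j\<bar>) summable_on range P" "(\<lambda>j. \<bar>J j\<bar>) summable_on range N"
    using so J by (simp_all add: summable_on_reindex inj o_def del: of_nat_Suc)
  then have "(\<lambda>j. \<bar>J j\<bar>) summable_on UNIV - {0}"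
    unfolding U(1) by (intro summable_on_Un_disjoint U(2))
  then have "(\<lambda>j. \<bar>J j\<bar>) summable_on insert 0 (UNIV - {0})" by (simp only: summable_on_insert_iff)
  then show "(\<lambda>j. \<bar>power_law_coupling \<alpha> j\<bar>) summable_on UNIV" by (simp add: J_def)
  fix x :: real
  define c where "c = (\<lambda>j. complex_of_real (J j) * (1 - cis (- (of_int j * x))))"
  have bd: "norm (complex_of_real (real (Suc k) powr - (1 + \<alpha>)) * (1 - cis y)) \<le> real (Suc k) powr - (1 + \<alpha>) * 2" for k y
    unfolding norm_mult using norm_one_minus_cis_le[of y] by (intro mult_mono) auto
  have "(c \<circ> Q) summable_on UNIV" if "\<And>k. J (Q k) = real (Suc k) powr - (1 + \<alpha>)" for Q
  proof (rule norm_summable_imp_summable_on, rule summable_comparison_test'[OF summable_mult2[OF sm, of 2]])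
    show "norm (norm ((c \<circ> Q) k)) \<le> real (Suc k) powr - (1 + \<alpha>) * 2" for k
      unfolding c_def o_def that real_norm_def abs_norm_cancel by (rule bd)
  qed
  from this[OF J(1)] this[OF J(2)] have hP: "((c \<circ> P) has_sum infsum (c \<circ> P) UNIV) UNIV" and hN: "((c \<circ> N) has_sum infsum (c \<circ> N) UNIV) UNIV"
    by (simp_all add: has_sum_infsum)
  have "(c has_sum (infsum (c \<circ> P) UNIV + infsum (c \<circ> N) UNIV)) (UNIV - {0})"
    unfolding U(1) using hP hN by (intro has_sum_Un_disjoint U(2)) (simp_all add: has_sum_reindex inj)
  moreover have "infsum (c \<circ> P) UNIV + infsum (c \<circ> N) UNIV = complex_of_real (dispersion \<alpha> x)"
  proof -
    have "(\<lambda>k. (c \<circ> P) k + (c \<circ> N) k) sums (infsum (c \<circ> P) UNIV + infsum (c \<circ> N) UNIV)"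
      by (intro sums_add has_sum_imp_sums hP hN)
    moreover have "(c \<circ> P) k + (c \<circ> N) k = complex_of_real (2 * real (Suc k) powr - (1 + \<alpha>) * (1 - cos (real (Suc k) * x)))" for k
    proof -
      have "of_int (P k) * x = real (Suc k) * x" "of_int (N k) * x = - (real (Suc k) * x)"
        by (simp_all add: P_def N_def algebra_simps)
      then have "(c \<circ> P) k + (c \<circ> N) k = complex_of_real (real (Suc k) powr - (1 + \<alpha>)) *
          ((1 - cis (- (real (Suc k) * x))) + (1 - cis (real (Suc k) * x)))"
        unfolding c_def o_def J by (simp only: distrib_left minus_minus)
      then show ?thesis by (simp add: complex_eq_iff del: of_nat_Suc)
    qed
    moreover have "(\<lambda>k. complex_of_real (2 * real (Suc k) powr - (1 + \<alpha>) * (1 - cos (real (Suc k) * x)))) sums complex_of_real (dispersion \<alpha> x)"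
      unfolding dispersion_def
      by (intro sums_of_real summable_sums summable_comparison_test'[OF summable_mult[OF sm, of 4]] norm_dispersion_term_le)
    ultimately show ?thesis by (simp add: sums_unique2)
  qed
  ultimately show "((\<lambda>j. of_real (power_law_coupling \<alpha> j) * (1 - cis (- (of_int j * x)))) has_sum complex_of_real (dispersion \<alpha> x)) (UNIV - {0})"
    by (simp add: c_def J_def)
qed

lemma symbol_power_law:
  assumes "\<alpha> > 0"
  shows "symbol (power_law_coupling \<alpha>) x = of_real (dispersion \<alpha> x)"
  unfolding symbol_def using power_law_coupling_has_sum(2)[OF assms] by (rule infsumI)

lemma dispersion_minus: "dispersion \<alpha> (- x) = dispersion \<alpha> x"
  by (simp add: dispersion_def)

text \<open>Reflecting the negative half turns \<open>c\<close> into \<open>- c\<close>, which a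
  bound uniform in \<open>c\<close> absorbs.\<close>

lemma norm_integral_cis_even_le:
  assumes q: "continuous_on {-pi..pi} q" and even: "\<And>x. q (- x) = q x"
    and B: "\<And>c. norm (integral {0..pi} (\<lambda>x. cis (c * x + q x))) \<le> B"
  shows "norm (integral {-pi..pi} (\<lambda>x. cis (c * x + q x))) \<le> 2 * B"
proof -
  have "integral {-pi..pi} (\<lambda>x. cis (c * x + q x)) =
      integral {-pi..0} (\<lambda>x. cis (c * x + q x)) + integral {0..pi} (\<lambda>x. cis (c * x + q x))"
    by (intro Henstock_Kurzweil_Integration.integral_combine[symmetric] integrable_continuous_real continuous_intros q) auto
  also have "integral {-pi..0} (\<lambda>x. cis (c * x + q x)) = integral {0..pi} (\<lambda>x. cis (- c * x + q x))"
    using Henstock_Kurzweil_Integration.integral_reflect_real[of pi 0 "\<lambda>x. cis (- c * x + q x)"] even by simp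
  finally show ?thesis using B[of c] B[of "- c"] by (smt (verit) norm_triangle_ineq)
qed

lemma norm_integral_cis_time_reverse:
  assumes "continuous_on {a..b} q"
  shows "norm (integral {a..b} (\<lambda>x. cis (c * x - t * q x))) = norm (integral {a..b} (\<lambda>x. cis (- c * x - (- t) * q x)))"
  by (rule norm_integral_cis_minus[symmetric]) (auto intro!: continuous_intros assms)

lemma oscillatory_bound:
  assumes "\<alpha> > 0"
  obtains K where "K > 0"
    "\<And>t c. t > 0 \<Longrightarrow> norm (integral {0..pi} (\<lambda>x. cis (c * x - t * dispersion \<alpha> x)))
       \<le> K * t powr - (if \<alpha> > 1 then 1/3 else 1/2)"
proof (cases "\<alpha> > 1")
  case True
  then show ?thesis using oscillatory_bound_cube_root[OF True] that by auto
next
  case False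
  define \<beta> where "\<beta> = 1 - \<alpha>"
  have \<beta>: "0 \<le> \<beta>" "\<beta> < 1" using False assms by (auto simp: \<beta>_def)
  define \<kappa> where "\<kappa> = (2 - 2 powr \<beta>) / 2"
  have \<kappa>: "\<kappa> > 0" using \<beta> powr_less_mono[of \<beta> 1 2] by (simp add: \<kappa>_def)
  show ?thesis
  proof (rule that[of "18 / sqrt \<kappa>"])
    fix t c :: real assume t: "t > 0"
    have "t powr - (1/2) = 1 / sqrt t"
      using t by (simp add: powr_minus_divide powr_half_sqrt)
    then have "18 / sqrt (t * \<kappa>) = 18 / sqrt \<kappa> * t powr - (1/2)"
      by (simp add: real_sqrt_mult)
    then show "norm (integral {0..pi} (\<lambda>x. cis (c * x - t * dispersion \<alpha> x)))
       \<le> 18 / sqrt \<kappa> * t powr - (if \<alpha> > 1 then 1/3 else 1/2)"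
      using oscillatory_bound_concave[OF \<beta> t, of c] False by (simp add: \<kappa>_def \<beta>_def)
  qed (use \<kappa> in simp)
qed

lemma kernel_decay:
  assumes \<alpha>: "\<alpha> > 0"
  obtains C where "C > 0"
    "\<And>t n. norm (fourier_coeff (\<lambda>x. exp (- (\<i> * of_real t) * symbol (power_law_coupling \<alpha>) x)) n)
       \<le> C * japanese_bracket t powr - (if \<alpha> > 1 then 1/3 else 1/2)"
proof -
  define r where "r = (if \<alpha> > 1 then 1/3 else 1/2 :: real)"
  have r: "0 < r" by (simp add: r_def)
  obtain K where K: "K > 0" and osc: "\<And>t c. t > 0 \<Longrightarrow>
      norm (integral {0..pi} (\<lambda>x. cis (c * x - t * dispersion \<alpha> x))) \<le> K * t powr - r"
    using oscillatory_bound[OF \<alpha>] unfolding r_def by blast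
  note cd = continuous_on_dispersion[OF \<alpha>]
  \<comment> \<open>The factor \<open>2 powr r\<close> pays for
    \<open>japanese_bracket t \<le> 2\<close> when \<open>\<bar>t\<bar> \<le> 1\<close> and for
    \<open>japanese_bracket t \<le> 2 \<bar>t\<bar>\<close> otherwise. The summand 1 in
    \<open>K + 1\<close> covers the trivial bound for small times.\<close>
  define C where "C = (K + 1) * 2 powr r"
  \<comment> \<open>The factor \<open>pi\<close> disappears in the end: passing to
    \<open>[-pi, pi]\<close> doubles the bound, and \<open>fourier_coeff\<close> divides by
    \<open>2 pi\<close>.\<close>
  have osc': "norm (integral {0..pi} (\<lambda>x. cis (c * x - t * dispersion \<alpha> x))) \<le> pi * (C * japanese_bracket t powr - r)" for t c
  proof -
    define I where "I = norm (integral {0..pi} (\<lambda>x. cis (c * x - t * dispersion \<alpha> x)))"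
    have jb: "japanese_bracket t = sqrt (1 + t\<^sup>2)"
      by (simp add: japanese_bracket_def powr_half_sqrt add_nonneg_nonneg)
    have jb1: "japanese_bracket t \<ge> 1" by (simp add: jb)
    have pi: "pi > 3" using pi_gt3 .
    show ?thesis
    proof (cases "\<bar>t\<bar> \<le> 1")
      case True
      have "japanese_bracket t \<le> 1 + \<bar>t\<bar>" unfolding jb
        by (intro real_le_lsqrt) (auto simp: power2_sum)
      then have "japanese_bracket t \<le> 2" using True by simp
      then have "2 powr - r \<le> japanese_bracket t powr - r" using jb1 r by (intro powr_mono2') auto
      then have "2 powr r * 2 powr - r \<le> 2 powr r * japanese_bracket t powr - r" by (intro mult_left_mono) auto
      then have "1 \<le> 2 powr r * japanese_bracket t powr - r" by (simp flip: powr_add)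
      then have "1 * 1 \<le> (K + 1) * (2 powr r * japanese_bracket t powr - r)" using K by (intro mult_mono) auto
      then have "pi * 1 \<le> pi * (C * japanese_bracket t powr - r)" by (intro mult_left_mono) (auto simp: C_def mult.assoc)
      moreover have "I \<le> pi - 0" unfolding I_def by (intro norm_integral_cis_le continuous_intros cd) auto
      ultimately show ?thesis unfolding I_def by linarith
    next
      case False
      have "I \<le> K * \<bar>t\<bar> powr - r"
      proof (cases "t > 0")
        case True
        then show ?thesis using osc[of t c] by (simp add: I_def)
      next
        case neg: False
        then show ?thesis using osc[of "- t" "- c"] False norm_integral_cis_time_reverse[OF cd, of 0 pi c t] by (simp add: I_def)
      qed
      moreover have "\<bar>t\<bar> powr - r \<le> 2 powr r * japanese_bracket t powr - r"
      proof -
        have "japanese_bracket t \<le> 2 * \<bar>t\<bar>" unfolding jb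
        proof (intro real_le_lsqrt)
          have "1 \<le> t\<^sup>2" using False power_mono[of 1 "\<bar>t\<bar>" 2] by simp
          then show "1 + t\<^sup>2 \<le> (2 * \<bar>t\<bar>)\<^sup>2" by (simp add: power_mult_distrib)
        qed simp
        then have "(2 * \<bar>t\<bar>) powr - r \<le> japanese_bracket t powr - r" using jb1 r by (intro powr_mono2') auto
        then have "2 powr r * (2 powr - r * \<bar>t\<bar> powr - r) \<le> 2 powr r * japanese_bracket t powr - r"
          by (intro mult_left_mono) (auto simp: powr_mult)
        moreover have "2 powr r * (2 powr - r * \<bar>t\<bar> powr - r) = \<bar>t\<bar> powr - r"
          by (simp add: powr_minus)
        ultimately show ?thesis by simp
      qed
      ultimately have "I \<le> K * (2 powr r * japanese_bracket t powr - r)"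
        using K mult_left_mono[of "\<bar>t\<bar> powr - r" _ K] by (meson less_imp_le order_trans)
      also have "\<dots> \<le> C * japanese_bracket t powr - r"
        using K by (simp add: C_def algebra_simps)
      also have "\<dots> \<le> pi * (C * japanese_bracket t powr - r)"
        using K pi by (intro mult_right_mono[of 1 pi, simplified]) (auto simp: C_def)
      finally show ?thesis by (simp add: I_def)
    qed
  qed
  have "norm (fourier_coeff (\<lambda>x. exp (- (\<i> * of_real t) * symbol (power_law_coupling \<alpha>) x)) n)
     \<le> C * japanese_bracket t powr - r" for t n
  proof -
    have e: "cis (of_int n * x) * exp (- (\<i> * of_real t) * symbol (power_law_coupling \<alpha>) x)
        = cis (of_int n * x + - t * dispersion \<alpha> x)" for x
      unfolding symbol_power_law[OF \<alpha>] cis_conv_exp exp_add[symmetric] by (simp add: algebra_simps)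
    have "norm (integral {-pi..pi} (\<lambda>x. cis (of_int n * x + - t * dispersion \<alpha> x))) \<le> 2 * (pi * (C * japanese_bracket t powr - r))"
      by (rule norm_integral_cis_even_le)
         (use osc' in \<open>auto simp: dispersion_minus intro!: continuous_intros cd\<close>)
    then show ?thesis
      unfolding fourier_coeff_def e by (simp add: norm_divide field_simps)
  qed
  moreover have "C > 0" using K by (simp add: C_def)
  ultimately show ?thesis using that unfolding r_def by blast
qed

theorem proposition4p1:
  fixes \<alpha> :: real
  assumes "\<alpha> > 0"
  shows "\<exists>C>0. \<forall>t::real. \<forall>\<phi>\<in>l1.
           linear_flow (power_law_coupling \<alpha>) t \<phi> \<in> linf \<and>
           linf_norm (linear_flow (power_law_coupling \<alpha>) t \<phi>)
             \<le> C * japanese_bracket t powr (- (if \<alpha> > 1 then 1/3 else 1/2)) * l1_norm \<phi>"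
proof -
  obtain C where "C > 0" and C: "\<And>t n.
      norm (fourier_coeff (\<lambda>x. exp (- (\<i> * of_real t) * symbol (power_law_coupling \<alpha>) x)) n)
       \<le> C * japanese_bracket t powr - (if \<alpha> > 1 then 1/3 else 1/2)"
    using kernel_decay[OF assms] by blast
  then show ?thesis
    using linear_flow_kernel_bound[OF power_law_coupling_has_sum(1)[OF assms] _ C] by blast
qed

end
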